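(* Let $T$ be a tree with at least $3$ vertices. Then \[ Z_1(T)=2+\max_{v\in V(T)}\Bigg(\max_{\substack{S\subseteq T\\ v\in V(S)}}\Bigg(\min_{P\in\mathcal{P}_S(v)}\sum_{w\in V(P)}\big(\deg_S(w)-2\big)\Bigg)\Bigg), \] where $S$ ranges over the subtrees (connected subgraphs) of $T$ containing $v$.
   Context: Filling rule: if a filled vertex has exactly one unfilled neighbor (and any number of filled neighbors), that neighbor becomes filled; "applying the filling rule in a subgraph $H$" means applying it with neighborhoods taken in $H$. The $Z_q$-Game on $G$ ($q\ge 0$ an integer): initially all vertices are unfilled; a player repeatedly performs one of the following operations until all vertices are filled: (1) for one token, change any vertex from unfilled to filled; (2) at no cost, apply the filling rule in $G$; (3) if $F$ is the current set of filled vertices and $U_1,\dots,U_k$ are the vertex sets of the connected components of $G[V(G)\setminus F]$ with $k\ge q+1$, the player announces a selection of at least $q+1$ of the $U_i$ to an oracle (an adversary), the oracle returns a nonempty subset $\{U_{i_1},\dots,U_{i_\ell}\}$ of the selected components, and the player may at no cost apply the filling rule in $G[F\cup U_{i_1}\cup\cdots\cup U_{i_\ell}]$. $Z_q(G)$ is the minimum number of tokens with which the player can guarantee that all vertices become filled, regardless of the oracle's responses. For a subtree $S$ and $w\in V(S)$, $\deg_S(w)$ is the degree of $w$ in $S$. $\mathcal{P}_S(v)$ is the set of maximal paths in $S$ having $v$ as an endpoint (paths with endpoint $v$ not contained in a longer path with endpoint $v$; if $S$ is the single vertex $v$, this is the one-vertex path). *)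

theory Defs
  imports Main
begin

definition simple_graph :: "'a set \<Rightarrow> 'a set set \<Rightarrow> bool" where
  "simple_graph V E \<longleftrightarrow> finite V \<and> (\<forall>e\<in>E. e \<subseteq> V \<and> card e = 2)"

definition adj_in :: "'a set set \<Rightarrow> 'a set \<Rightarrow> 'a \<Rightarrow> 'a \<Rightarrow> bool" where
  "adj_in E W x y \<longleftrightarrow> x \<in> W \<and> y \<in> W \<and> {x, y} \<in> E"

definition connected_graph :: "'a set \<Rightarrow> 'a set set \<Rightarrow> bool" where
  "connected_graph V E \<longleftrightarrow> V \<noteq> {} \<and> (\<forall>x\<in>V. \<forall>y\<in>V. (adj_in E V)\<^sup>*\<^sup>* x y)"

definition walk_edges :: "'a set set \<Rightarrow> 'a list \<Rightarrow> bool" where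
  "walk_edges E p \<longleftrightarrow> (\<forall>i. Suc i < length p \<longrightarrow> {p ! i, p ! Suc i} \<in> E)"

definition is_cycle :: "'a set set \<Rightarrow> 'a list \<Rightarrow> bool" where
  "is_cycle E c \<longleftrightarrow> length c \<ge> 3 \<and> distinct c \<and> walk_edges E c \<and> {last c, hd c} \<in> E"

definition is_tree :: "'a set \<Rightarrow> 'a set set \<Rightarrow> bool" where
  "is_tree V E \<longleftrightarrow> simple_graph V E \<and> connected_graph V E \<and> \<not> (\<exists>c. is_cycle E c)"

definition is_subtree :: "'a set \<Rightarrow> 'a set set \<Rightarrow> 'a set \<Rightarrow> 'a set set \<Rightarrow> bool" where
  "is_subtree V E W ES \<longleftrightarrow> W \<subseteq> V \<and> ES \<subseteq> E \<and> is_tree W ES"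

definition deg :: "'a set set \<Rightarrow> 'a \<Rightarrow> nat" where
  "deg ES w = card {e \<in> ES. w \<in> e}"

definition path_from :: "'a set set \<Rightarrow> 'a \<Rightarrow> 'a list \<Rightarrow> bool" where
  "path_from ES v p \<longleftrightarrow> p \<noteq> [] \<and> hd p = v \<and> distinct p \<and> walk_edges ES p"

definition maximal_path_from :: "'a set set \<Rightarrow> 'a \<Rightarrow> 'a list \<Rightarrow> bool" where
  "maximal_path_from ES v p \<longleftrightarrow> path_from ES v p \<and>
     \<not> (\<exists>p'. path_from ES v p' \<and> set p \<subset> set p')"

definition components :: "'a set set \<Rightarrow> 'a set \<Rightarrow> 'a set set" where
  "components E W = {C. \<exists>x\<in>W. C = {y. (adj_in E W)\<^sup>*\<^sup>* x y}}"

definition fill_step :: "'a set set \<Rightarrow> 'a set \<Rightarrow> 'a set \<Rightarrow> 'a set \<Rightarrow> bool" where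
  "fill_step E W F F' \<longleftrightarrow> (\<exists>v\<in>F \<inter> W. \<exists>u. {x \<in> W. {v, x} \<in> E} - F = {u} \<and> F' = insert u F)"

text \<open>zq_win q V E k F: from filled set F, the player can guarantee that all vertices
  become filled using at most k further tokens.\<close>
inductive zq_win :: "nat \<Rightarrow> 'a set \<Rightarrow> 'a set set \<Rightarrow> nat \<Rightarrow> 'a set \<Rightarrow> bool"
  for q :: nat and V :: "'a set" and E :: "'a set set" where
  finished: "F = V \<Longrightarrow> zq_win q V E k F"
| token: "v \<in> V - F \<Longrightarrow> zq_win q V E k (insert v F) \<Longrightarrow> zq_win q V E (Suc k) F"
| force: "fill_step E V F F' \<Longrightarrow> zq_win q V E k F' \<Longrightarrow> zq_win q V E k F"
| query: "S \<subseteq> components E (V - F) \<Longrightarrow> card S \<ge> Suc q \<Longrightarrow>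
     (\<forall>T. T \<subseteq> S \<and> T \<noteq> {} \<longrightarrow>
        (\<exists>F'. (fill_step E (F \<union> \<Union>T))\<^sup>*\<^sup>* F F' \<and> zq_win q V E k F'))
     \<Longrightarrow> zq_win q V E k F"

definition Zq :: "nat \<Rightarrow> 'a set \<Rightarrow> 'a set set \<Rightarrow> nat" where
  "Zq q V E = (LEAST k. zq_win q V E k {})"

end

theory Submission
  imports Defs
begin

text \<open>
  Root a subtree \<open>S\<close> at \<open>v\<close> and let \<open>c w\<close> be the number of children of \<open>w\<close>. Along a path from the
  root to a leaf the degree sum increased by 2 is the sum of \<open>c w - 1\<close> over the inner vertices, so
  the optimum over \<open>S\<close> obeys a recursion: the value at \<open>v\<close> is at least \<open>k\<close> iff \<open>k = 0\<close> or there are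
  \<open>c > 0\<close> branches at \<open>v\<close>, all of value at least \<open>k + 1 - c\<close>.

  Lower bound: the oracle maintains a vertex \<open>v\<close> with at least two unfilled branches witnessing a
  value above the number of remaining tokens. Each token destroys at most one of them; when a
  single branch is left, the oracle moves into it. When asked, it returns either a component off
  these branches or at least two branches at \<open>v\<close>, so nothing in the branches can be forced.

  Upper bound: a position without free progress consists of a filled vertex \<open>r\<close> and at least
  two entirely unfilled branches at \<open>r\<close>, everything else being filled. A walk that keeps leaving
  each vertex along its largest branch (never backwards) finds a place for a token that lowers
  the value of every position the oracle can reach.
\<close>

subsection \<open>Values of rooted branches\<close>

definition nbr :: "'a set set \<Rightarrow> 'a \<Rightarrow> 'a set" where
  "nbr E v = {x. {v, x} \<in> E}"

lemma two_elements:
  assumes "2 \<le> card S"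
  obtains a b where "a \<in> S" "b \<in> S" "a \<noteq> b"
proof -
  have "finite S" "\<not> card S \<le> Suc 0" using assms card.infinite by fastforce+
  then show ?thesis using that card_le_Suc0_iff_eq by metis
qed

lemma nbr_sym: "x \<in> nbr E v \<Longrightarrow> v \<in> nbr E x"
  by (simp add: nbr_def insert_commute)

text \<open>\<open>branching E v N k\<close>: some subtree rooted at \<open>v\<close>, with all children of the root in \<open>N\<close>, has value
  at least \<open>k\<close>. Truncated subtraction is harmless since values are never negative.\<close>

inductive branching :: "'a set set \<Rightarrow> 'a \<Rightarrow> 'a set \<Rightarrow> nat \<Rightarrow> bool" for E where
  zero: "branching E v N 0"
| node: "M \<subseteq> N \<Longrightarrow> M \<noteq> {} \<Longrightarrow>
    (\<And>n. n \<in> M \<Longrightarrow> branching E n (nbr E n - {v}) (Suc k - card M)) \<Longrightarrow> branching E v N k"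

lemma branching_mono: "branching E v N k \<Longrightarrow> N \<subseteq> N' \<Longrightarrow> branching E v N' k"
  by (erule branching.cases) (metis branching.zero, metis branching.node subset_trans)

lemma branching_antimono: "branching E v N k \<Longrightarrow> j \<le> k \<Longrightarrow> branching E v N j"
proof (induction arbitrary: j rule: branching.induct)
  case (zero v N)
  then show ?case by (simp add: branching.zero)
next
  case (node M N v k)
  show ?case
  proof (rule branching.node[OF node(1,2)])
    fix n assume "n \<in> M"
    then show "branching E n (nbr E n - {v}) (Suc j - card M)"
      using node.IH[of n "Suc j - card M"] node.prems by simp
  qed
qed

text \<open>A root with a single child contributes 1 - 1 = 0, so a value passes upwards through it
  unchanged.\<close>

lemma branching_child:
  assumes "branching E n (nbr E n - {v}) k" "n \<in> N"
  shows "branching E v N k"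
  by (rule branching.node[of "{n}"]) (use assms in auto)

lemma branching_ex:
  assumes "branching E v N k" "k > 0"
  shows "\<exists>M. M \<subseteq> N \<and> M \<noteq> {} \<and> (\<forall>n\<in>M. branching E n (nbr E n - {v}) (Suc k - card M))"
  using assms(1)
proof (cases rule: branching.cases)
  case zero
  then show ?thesis using assms(2) by simp
next
  case (node M)
  then show ?thesis by blast
qed

lemma not_branching_empty: "branching E v {} k \<Longrightarrow> k = 0"
  by (erule branching.cases) auto

lemma branching_one: "2 \<le> card N \<Longrightarrow> branching E v N 1"
  by (rule branching.node[of N]) (auto intro: branching.zero)

text \<open>The largest branch other than \<open>p\<close> may be removed: if the value did not drop,
  adding that branch back would raise it above \<open>k\<close>.\<close>

lemma branching_remove:
  assumes "finite N" "k > 0" and le: "\<not> branching E x N (Suc k)" and ge: "branching E x N k"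
    and p: "\<not> (p \<in> N \<and> branching E p (nbr E p - {x}) k)"
  obtains y where "y \<in> N" "y \<noteq> p" "\<not> branching E x (N - {y}) k"
proof -
  define B where "B n j \<longleftrightarrow> branching E n (nbr E n - {x}) j" for n j
  \<comment> \<open>\<open>g n\<close> is the value of branch \<open>n\<close> cut off at
    \<open>k\<close>. The cutoff loses nothing: a branch in \<open>N\<close> of value
    \<open>Suc k\<close> would alone give \<open>x\<close> that value, contrary to
    \<open>le\<close>.\<close>
  define g where "g n = Max {j. j \<le> k \<and> B n j}" for n
  have B_down: "B n i" if "B n j" "i \<le> j" for n i j
    using that branching_antimono unfolding B_def by metis
  have B_le: "j \<le> k" if "n \<in> N" "B n j" for n j
  proof (rule ccontr)
    assume "\<not> j \<le> k"
    then have "B n (Suc k)" using B_down that by simp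
    then show False using le that(1) branching_child unfolding B_def by metis
  qed
  have g: "B n j \<longleftrightarrow> j \<le> g n" if "n \<in> N" for n j
  proof
    assume "B n j"
    then show "j \<le> g n" unfolding g_def using B_le[OF that] by (intro Max_ge) auto
  next
    have "B n 0" by (simp add: B_def branching.zero)
    then have "g n \<in> {j. j \<le> k \<and> B n j}" unfolding g_def by (intro Max_in) auto
    then show "j \<le> g n \<Longrightarrow> B n j" using B_down by auto
  qed
  \<comment> \<open>A family inside \<open>{p}\<close> is a singleton and demands value
    \<open>k\<close> of branch \<open>p\<close>, which the last assumption excludes. So every
    witnessing family has a member other than \<open>p\<close>.\<close>
  have other: "\<exists>n\<in>M. n \<noteq> p"
    if "M \<subseteq> N" "M \<noteq> {}" "\<And>n. n \<in> M \<Longrightarrow> B n (Suc k - card M)" for M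
  proof (rule ccontr)
    assume "\<not> (\<exists>n\<in>M. n \<noteq> p)"
    with that(2) have "M = {p}" by auto
    then show False using that(1) that(3)[of p] p by (simp add: B_def)
  qed
  obtain M0 where "M0 \<subseteq> N" "M0 \<noteq> {}" "\<And>n. n \<in> M0 \<Longrightarrow> B n (Suc k - card M0)"
    using branching_ex[OF ge \<open>k > 0\<close>] unfolding B_def by blast
  then have "N - {p} \<noteq> {}" using other[of M0] by auto
  then have "Max (g ` (N - {p})) \<in> g ` (N - {p})" using \<open>finite N\<close> by (intro Max_in) auto
  then obtain y where y: "y \<in> N - {p}" "g y = Max (g ` (N - {p}))" by fastforce
  have g_le: "g n \<le> g y" if "n \<in> N - {p}" for n
    unfolding y(2) using that \<open>finite N\<close> by (intro Max_ge) auto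
  have "\<not> branching E x (N - {y}) k"
  proof
    assume "branching E x (N - {y}) k"
    then obtain M where M: "M \<subseteq> N - {y}" "M \<noteq> {}" "\<And>n. n \<in> M \<Longrightarrow> B n (Suc k - card M)"
      using branching_ex[of E x "N - {y}" k] \<open>k > 0\<close> unfolding B_def by blast
    obtain n where n: "n \<in> M" "n \<noteq> p" using other[of M] M by auto
    \<comment> \<open>\<open>y\<close> is at least as large as \<open>n\<close>, so it meets the
      threshold of \<open>M\<close>. Enlarging \<open>M\<close> by \<open>y\<close> keeps that
      threshold while the value rises to \<open>Suc k\<close>.\<close>
    have "B y (Suc k - card M)"
      using M(1) M(3)[OF n(1)] n y(1) g[of n] g[of y] g_le[of n] by auto
    moreover have "finite M" "y \<notin> M" using M(1) \<open>finite N\<close> finite_subset by auto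
    ultimately have "branching E x N (Suc k)"
      using M(1,3) y(1) unfolding B_def
      by (intro branching.node[where M="insert y M" and k="Suc k"]) (simp_all, blast+)
    then show False using le by simp
  qed
  then show thesis using that y(1) by auto
qed

subsection \<open>Walks and paths\<close>

lemma walk_edges_Cons:
  "walk_edges E (x # p) \<longleftrightarrow> p = [] \<or> {x, hd p} \<in> E \<and> walk_edges E p"
  by (cases p) (auto simp: walk_edges_def nth_Cons split: nat.splits)

lemma walk_edges_append:
  "walk_edges E (p @ q) \<longleftrightarrow>
     walk_edges E p \<and> walk_edges E q \<and> (p \<noteq> [] \<longrightarrow> q \<noteq> [] \<longrightarrow> {last p, hd q} \<in> E)"
proof (induction p)
  case Nil
  then show ?case by (simp add: walk_edges_def)
next
  case (Cons a p)
  then show ?case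
    by (cases "p = []"; cases "q = []") (auto simp: walk_edges_Cons walk_edges_def[of _ "[]"])
qed

lemma walk_edges_mono: "walk_edges E p \<Longrightarrow> E \<subseteq> E' \<Longrightarrow> walk_edges E' p"
  by (auto simp: walk_edges_def)

lemma rtranclp_adj_in_path:
  assumes "(adj_in E W)\<^sup>*\<^sup>* x y" "x \<in> W"
  shows "\<exists>p. p \<noteq> [] \<and> hd p = x \<and> last p = y \<and> distinct p \<and> walk_edges E p \<and> set p \<subseteq> W"
  using assms
proof (induction rule: rtranclp_induct)
  case base
  then show ?case by (intro exI[of _ "[x]"]) (auto simp: walk_edges_def)
next
  case (step y z)
  then obtain p where p: "p \<noteq> []" "hd p = x" "last p = y" "distinct p" "walk_edges E p" "set p \<subseteq> W"
    by auto
  have z: "z \<in> W" "{y, z} \<in> E" using step by (auto simp: adj_in_def)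
  show ?case
  proof (cases "z \<in> set p")
    case True
    then obtain p1 p2 where "p = p1 @ z # p2" by (auto simp: in_set_conv_decomp)
    then show ?thesis using p
      by (intro exI[of _ "p1 @ [z]"]) (auto simp: walk_edges_append walk_edges_Cons hd_append)
  next
    case False
    then show ?thesis using p z
      by (intro exI[of _ "p @ [z]"]) (auto simp: walk_edges_append walk_edges_def[of _ "[_]"])
  qed
qed

lemma adj_in_sym: "adj_in E W x y \<Longrightarrow> adj_in E W y x"
  by (simp add: adj_in_def insert_commute)

lemma rtranclp_adj_in_sym: "(adj_in E W)\<^sup>*\<^sup>* x y \<Longrightarrow> (adj_in E W)\<^sup>*\<^sup>* y x"
  by (metis adj_in_sym sympI symp_rtranclp sympD)

text \<open>The segment of \<open>p\<close> from \<open>i\<close> to \<open>j\<close>, closed by the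
  chord, would otherwise be a cycle.\<close>

lemma acyclic_chord:
  assumes ac: "\<not> (\<exists>c. is_cycle E c)" and p: "distinct p" "walk_edges E p"
    and ij: "i < j" "j < length p" "{p ! i, p ! j} \<in> E"
  shows "j = Suc i"
proof (rule ccontr)
  assume ne: "j \<noteq> Suc i"
  define c where "c = take (Suc j - i) (drop i p)"
  have len: "length c = Suc j - i" using ij by (simp add: c_def)
  have nth: "c ! l = p ! (i + l)" if "l < length c" for l
    using that len ij by (simp add: c_def)
  have "walk_edges E c" using p(2) nth len ij by (auto simp: walk_edges_def)
  moreover have "hd c = p ! i" "last c = p ! j"
    using len nth ij by (auto simp: hd_conv_nth last_conv_nth simp flip: length_greater_0_conv)
  ultimately have "is_cycle E c"
    using len p(1) ij ne by (auto simp: is_cycle_def c_def insert_commute)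
  then show False using ac by blast
qed

text \<open>A local form of maximality suited to induction along a path;
  \<open>maximal_path_iff\<close> shows that it agrees with \<open>maximal_path_from\<close> in
  acyclic graphs.\<close>

definition leaf_path :: "'a set set \<Rightarrow> 'a list \<Rightarrow> bool" where
  "leaf_path ES p \<longleftrightarrow> (\<forall>z. {last p, z} \<in> ES \<longrightarrow> z \<in> set p)"

text \<open>Needed because maximality compares vertex sets, not lists. The next vertex of
  \<open>p\<close> occurs on \<open>p'\<close>; distinctness puts it after the common initial part,
  and skipping a position would create a chord of \<open>p'\<close>.\<close>

lemma path_prefix:
  assumes ac: "\<not> (\<exists>c. is_cycle ES c)"
    and p: "path_from ES v p" and p': "path_from ES v p'" and sub: "set p \<subseteq> set p'"
    and i: "i < length p"
  shows "i < length p' \<and> p' ! i = p ! i"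
  using i
proof (induction i rule: less_induct)
  case (less i)
  have d: "distinct p" "distinct p'" "walk_edges ES p" "walk_edges ES p'" "p \<noteq> []" "p' \<noteq> []"
    using p p' by (auto simp: path_from_def)
  show ?case
  proof (cases i)
    case 0
    then show ?thesis using p p' by (auto simp: path_from_def hd_conv_nth)
  next
    case (Suc m)
    have m: "m < length p'" "p' ! m = p ! m" "m < length p" using less Suc by auto
    have "p ! i \<in> set p'" using sub less.prems by auto
    then obtain j where j: "j < length p'" "p' ! j = p ! i" by (auto simp: in_set_conv_nth)
    have e: "{p' ! m, p' ! j} \<in> ES"
      using d(3) Suc less.prems m(2) j(2) by (auto simp: walk_edges_def)
    have "j \<noteq> m" using m j(2) d(1) Suc less.prems by (auto simp: nth_eq_iff_index_eq)
    moreover have "\<not> j < m"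
    proof
      assume jm: "j < m"
      then have "p' ! j = p ! j" using less.IH[of j] Suc less.prems by simp
      then show False using j(2) d(1) jm Suc less.prems by (auto simp: nth_eq_iff_index_eq)
    qed
    ultimately have "m < j" by simp
    then have "j = Suc m" using acyclic_chord[OF ac d(2,4) _ j(1) e] by blast
    then show ?thesis using j Suc by simp
  qed
qed

lemma maximal_path_iff:
  assumes "\<not> (\<exists>c. is_cycle ES c)"
  shows "maximal_path_from ES v p \<longleftrightarrow> path_from ES v p \<and> leaf_path ES p"
proof
  assume max: "maximal_path_from ES v p"
  then have p: "path_from ES v p" by (simp add: maximal_path_from_def)
  have "z \<in> set p" if z: "{last p, z} \<in> ES" for z
  proof (rule ccontr)
    assume "z \<notin> set p"
    then have "path_from ES v (p @ [z])" "set p \<subset> set (p @ [z])"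
      using p z by (auto simp: path_from_def walk_edges_append walk_edges_def[of _ "[_]"])
    then show False using max unfolding maximal_path_from_def by blast
  qed
  then show "path_from ES v p \<and> leaf_path ES p" using p by (simp add: leaf_path_def)
next
  assume p: "path_from ES v p \<and> leaf_path ES p"
  have False if p': "path_from ES v p'" "set p \<subset> set p'" for p'
  proof -
    have pre: "i < length p' \<and> p' ! i = p ! i" if "i < length p" for i
      using path_prefix[OF assms _ p'(1) _ that] p p'(2) by blast
    have ne: "p \<noteq> []" and d: "distinct p" "distinct p'" "walk_edges ES p'"
      using p p' by (auto simp: path_from_def)
    have "card (set p) < card (set p')" using p'(2) by (simp add: psubset_card_mono)
    then have len: "length p < length p'" using d by (simp add: distinct_card)
    have last: "last p = p' ! (length p - 1)" using pre[of "length p - 1"] ne by (simp add: last_conv_nth)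
    have "{p' ! (length p - 1), p' ! length p} \<in> ES"
      using d(3) len ne unfolding walk_edges_def
      by (metis One_nat_def Suc_pred length_greater_0_conv)
    then have "p' ! length p \<in> set p" using p last by (simp add: leaf_path_def)
    then obtain i where i: "i < length p" "p ! i = p' ! length p" by (auto simp: in_set_conv_nth)
    then have "p' ! i = p' ! length p" using pre by simp
    then show False using d(2) len i(1) by (auto simp: nth_eq_iff_index_eq)
  qed
  then show "maximal_path_from ES v p" using p by (auto simp: maximal_path_from_def)
qed

lemma deg_eq_card_nbr:
  assumes "simple_graph W ES"
  shows "deg ES w = card (nbr ES w)"
proof -
  have "{e \<in> ES. w \<in> e} = (\<lambda>x. {w, x}) ` nbr ES w"
  proof
    show "{e \<in> ES. w \<in> e} \<subseteq> (\<lambda>x. {w, x}) ` nbr ES w"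
    proof
      fix e assume e: "e \<in> {e \<in> ES. w \<in> e}"
      then have "card e = 2" using assms by (auto simp: simple_graph_def)
      then obtain x where "e = {w, x}" using e by (auto simp: card_2_iff)
      then show "e \<in> (\<lambda>x. {w, x}) ` nbr ES w" using e by (auto simp: nbr_def)
    qed
  qed (auto simp: nbr_def)
  moreover have "inj_on (\<lambda>x. {w, x}) (nbr ES w)" by (auto simp: inj_on_def doubleton_eq_iff)
  ultimately show ?thesis by (simp add: deg_def card_image)
qed

lemma path_in_graph:
  assumes "simple_graph W ES" "path_from ES v p" "v \<in> W"
  shows "set p \<subseteq> W"
proof
  fix x assume "x \<in> set p"
  then obtain i where i: "i < length p" "x = p ! i" by (auto simp: in_set_conv_nth)
  show "x \<in> W"
  proof (cases i)
    case 0
    then show ?thesis using i assms by (auto simp: path_from_def hd_conv_nth)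
  next
    case (Suc m)
    then have "{p ! m, x} \<in> ES" using i assms(2) by (auto simp: path_from_def walk_edges_def)
    then show ?thesis using assms(1) by (auto simp: simple_graph_def)
  qed
qed

text \<open>Ensures that the \<open>Min\<close> over maximal paths is attained. A longest path is
  maximal because a larger vertex set forces a longer path.\<close>

lemma maximal_paths_finite_nonempty:
  assumes "simple_graph W ES" "v \<in> W"
  shows "finite {p. maximal_path_from ES v p}" "{p. maximal_path_from ES v p} \<noteq> {}"
proof -
  let ?P = "{p. path_from ES v p}"
  have "?P \<subseteq> {xs. set xs \<subseteq> W \<and> distinct xs}"
    using path_in_graph[OF assms(1) _ assms(2)] by (auto simp: path_from_def)
  moreover have "finite {xs. set xs \<subseteq> W \<and> distinct xs}"
    using assms(1) by (intro finite_subset_distinct) (simp add: simple_graph_def)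
  ultimately have fin: "finite ?P" by (rule finite_subset)
  then show "finite {p. maximal_path_from ES v p}"
    by (rule rev_finite_subset) (auto simp: maximal_path_from_def)
  have "[v] \<in> ?P" by (auto simp: path_from_def walk_edges_def)
  then have "Max (length ` ?P) \<in> length ` ?P" using fin by (intro Max_in) auto
  then obtain p where p: "path_from ES v p" "length p = Max (length ` ?P)" by fastforce
  have "\<not> (path_from ES v p' \<and> set p \<subset> set p')" for p'
  proof
    assume p': "path_from ES v p' \<and> set p \<subset> set p'"
    then have "card (set p) < card (set p')" by (simp add: psubset_card_mono)
    then have "length p < length p'" using p p' by (simp add: path_from_def distinct_card)
    moreover have "length p' \<le> Max (length ` ?P)" using p' fin by (intro Max_ge) auto
    ultimately show False using p(2) by simp
  qed
  then have "maximal_path_from ES v p" using p(1) by (auto simp: maximal_path_from_def)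
  then show "{p. maximal_path_from ES v p} \<noteq> {}" by blast
qed

subsection \<open>Branches of a tree\<close>

locale tree =
  fixes V :: "'a set" and E :: "'a set set"
  assumes tree: "is_tree V E"
begin

text \<open>For \<open>n\<close> adjacent to \<open>v\<close> this is the component of
  \<open>n\<close> after deletion of \<open>v\<close>.\<close>

definition branch :: "'a \<Rightarrow> 'a \<Rightarrow> 'a set" where
  "branch v n = {y. (adj_in E (V - {v}))\<^sup>*\<^sup>* n y}"

definition branches :: "'a \<Rightarrow> 'a set \<Rightarrow> 'a set" where
  "branches v N = (\<Union>n\<in>N. branch v n)"

lemma finite_V [simp]: "finite V"
  using tree by (simp add: is_tree_def simple_graph_def)

lemma acyclic: "\<not> (\<exists>c. is_cycle E c)"
  using tree by (simp add: is_tree_def)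

lemma edge: "{x, y} \<in> E \<Longrightarrow> x \<in> V \<and> y \<in> V \<and> x \<noteq> y"
  using tree unfolding is_tree_def simple_graph_def by fastforce

lemma nbr_in: "x \<in> nbr E v \<Longrightarrow> x \<in> V \<and> v \<in> V \<and> x \<noteq> v"
  using edge by (auto simp: nbr_def)

lemma finite_nbr [simp]: "finite (nbr E v)"
  by (rule finite_subset[OF _ finite_V]) (use nbr_in in auto)

lemma branch_self [simp]: "n \<in> branch v n"
  by (simp add: branch_def)

lemma branch_subset:
  assumes "n \<in> nbr E v"
  shows "branch v n \<subseteq> V - {v}"
proof
  fix y assume "y \<in> branch v n"
  then have "(adj_in E (V - {v}))\<^sup>*\<^sup>* n y" by (simp add: branch_def)
  then show "y \<in> V - {v}"
    by (cases rule: rtranclp.cases) (use nbr_in[OF assms] in \<open>auto simp: adj_in_def\<close>)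
qed

lemma branch_adj:
  "y \<in> branch v n \<Longrightarrow> {y, z} \<in> E \<Longrightarrow> z \<noteq> v \<Longrightarrow> n \<in> nbr E v \<Longrightarrow> z \<in> branch v n"
proof -
  assume a: "y \<in> branch v n" "{y, z} \<in> E" "z \<noteq> v" "n \<in> nbr E v"
  have "y \<noteq> v"
    using branch_subset a(1,4) by auto
  then have "adj_in E (V - {v}) y z" using a edge by (auto simp: adj_in_def)
  then show ?thesis using a(1) unfolding branch_def by auto
qed

text \<open>A path from \<open>n\<close> to \<open>m\<close> avoiding \<open>v\<close> would close
  to a cycle through \<open>v\<close>.\<close>

lemma branch_nbr_eq:
  assumes "n \<in> nbr E v" "m \<in> nbr E v" "m \<in> branch v n"
  shows "m = n"
proof (rule ccontr)
  assume ne: "m \<noteq> n"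
  have "n \<in> V - {v}" using assms nbr_in by auto
  then obtain p where p: "p \<noteq> []" "hd p = n" "last p = m" "distinct p" "walk_edges E p"
      "set p \<subseteq> V - {v}"
    using rtranclp_adj_in_path[of E "V - {v}" n m] assms(3) by (auto simp: branch_def)
  then have "length p \<noteq> 1" using ne by (auto simp: length_Suc_conv)
  then have "2 \<le> length p" using p(1) by (cases p) (auto simp: Suc_le_eq)
  then have "is_cycle E (v # p)"
    using p assms by (auto simp: is_cycle_def walk_edges_Cons nbr_def insert_commute)
  then show False using acyclic by blast
qed

lemma branch_disjoint:
  assumes "n \<in> nbr E v" "m \<in> nbr E v" "y \<in> branch v n" "y \<in> branch v m"
  shows "m = n"
proof -
  have "(adj_in E (V - {v}))\<^sup>*\<^sup>* n m"
    using assms(3,4) rtranclp_adj_in_sym unfolding branch_def by (metis mem_Collect_eq rtranclp_trans)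
  then show ?thesis using assms branch_nbr_eq by (simp add: branch_def)
qed

text \<open>A walk from \<open>m\<close> that avoids \<open>n\<close> never meets \<open>v\<close>,
  since distinct neighbors of \<open>n\<close> lie in distinct branches at \<open>n\<close>.\<close>

lemma branch_child:
  assumes "n \<in> nbr E v" "m \<in> nbr E n" "m \<noteq> v"
  shows "branch n m \<subseteq> branch v n - {n}"
proof
  fix y assume y: "y \<in> branch n m"
  then have "(adj_in E (V - {n}))\<^sup>*\<^sup>* m y" by (simp add: branch_def)
  then have "y \<in> branch v n"
  proof (induction rule: rtranclp_induct)
    case base
    then show ?case using branch_adj[of n v n m] assms by (auto simp: nbr_def)
  next
    case (step y z)
    have "z \<in> branch n m" using step(1,2) by (simp add: branch_def)
    then have "z \<noteq> v" using branch_nbr_eq[of m n v] assms nbr_sym by metis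
    then show ?case using step branch_adj[of y v n z] assms by (auto simp: adj_in_def)
  qed
  then show "y \<in> branch v n - {n}" using branch_subset[OF assms(2)] y by auto
qed

lemma branch_cases:
  assumes "n \<in> nbr E v" "y \<in> branch v n" "y \<noteq> n"
  obtains m where "m \<in> nbr E n" "m \<noteq> v" "y \<in> branch n m"
proof -
  have "(adj_in E (V - {v}))\<^sup>*\<^sup>* n y" using assms by (simp add: branch_def)
  then have "y = n \<or> (\<exists>m. m \<in> nbr E n \<and> m \<noteq> v \<and> y \<in> branch n m)"
  proof (induction rule: rtranclp_induct)
    case base
    then show ?case by simp
  next
    case (step y z)
    have yz: "{y, z} \<in> E" "z \<noteq> v" using step by (auto simp: adj_in_def)
    show ?case
    proof (cases "y = n \<or> z = n")
      case True
      then show ?thesis using yz branch_self by (auto simp: nbr_def)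
    next
      case False
      then obtain m where "m \<in> nbr E n" "m \<noteq> v" "y \<in> branch n m" using step by auto
      then show ?thesis using branch_adj[of y n m z] yz False by auto
    qed
  qed
  then show ?thesis using assms(3) that by auto
qed

lemma vertex_cases:
  assumes "v \<in> V" "y \<in> V" "y \<noteq> v"
  obtains n where "n \<in> nbr E v" "y \<in> branch v n"
proof -
  have "(adj_in E V)\<^sup>*\<^sup>* v y" using tree assms by (auto simp: is_tree_def connected_graph_def)
  then have "y = v \<or> (\<exists>n. n \<in> nbr E v \<and> y \<in> branch v n)"
  proof (induction rule: rtranclp_induct)
    case base
    then show ?case by simp
  next
    case (step y z)
    have yz: "{y, z} \<in> E" using step by (auto simp: adj_in_def)
    show ?case
    proof (cases "y = v \<or> z = v")
      case True
      then show ?thesis using yz branch_self by (auto simp: nbr_def)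
    next
      case False
      then obtain m where "m \<in> nbr E v" "y \<in> branch v m" using step by auto
      then show ?thesis using branch_adj[of y v m z] yz False by auto
    qed
  qed
  then show ?thesis using assms(3) that by auto
qed

lemma branch_compl:
  assumes "n \<in> nbr E v"
  shows "V - branch v n \<subseteq> branch n v"
proof
  fix y assume y: "y \<in> V - branch v n"
  show "y \<in> branch n v"
  proof (cases "y = v")
    case False
    then obtain m where "m \<in> nbr E v" "y \<in> branch v m"
      using vertex_cases[of v y] y nbr_in[OF assms] by auto
    moreover from this y have "m \<noteq> n" by auto
    ultimately show ?thesis using branch_child[of v n m] assms nbr_sym[of n] by auto
  qed simp
qed

lemma connected_sub_branch:
  assumes "(adj_in E U)\<^sup>*\<^sup>* x y" "x \<in> branch v n" "v \<notin> U" "n \<in> nbr E v"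
  shows "y \<in> branch v n"
  using assms(1,2)
proof (induction rule: rtranclp_induct)
  case (step y z)
  then show ?case using branch_adj[of y v n z] assms(3,4) by (auto simp: adj_in_def)
qed

lemma branch_connected:
  assumes "y \<in> branch v n" "n \<in> nbr E v" "branch v n \<subseteq> U"
  shows "(adj_in E U)\<^sup>*\<^sup>* n y"
proof -
  have "(adj_in E (V - {v}))\<^sup>*\<^sup>* n y" using assms by (simp add: branch_def)
  then show ?thesis
  proof (induction rule: rtranclp_induct)
    case (step y z)
    have "y \<in> branch v n" "z \<in> branch v n"
      using step(1,2) by (auto simp: branch_def)
    then show ?case using step assms(3) by (auto simp: adj_in_def intro: rtranclp.rtrancl_into_rtrancl)
  qed simp
qed

text \<open>The oracle needs a witness with at least two branches. Descending through single-child
  roots preserves the value, and a positive value cannot end in \<open>zero\<close>.\<close>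

lemma branchingE_two:
  assumes "branching E v N k" "k > 0" "N \<subseteq> nbr E v"
  shows "\<exists>v' M. M \<subseteq> nbr E v' \<and> 2 \<le> card M \<and> branches v' M \<subseteq> branches v N \<and>
    (\<forall>n\<in>M. branching E n (nbr E n - {v'}) (Suc k - card M))"
  using assms
proof (induction rule: branching.induct)
  case (node M N v k)
  have "M \<subseteq> nbr E v" using node.hyps(1) node.prems(2) by blast
  then have "finite M" using finite_nbr finite_subset by blast
  then have "card M > 0" using node.hyps(2) by (simp add: card_gt_0_iff)
  then consider "card M = 1" | "2 \<le> card M" by linarith
  then show ?case
  proof cases
    case 1
    then obtain n where n: "M = {n}" by (auto simp: card_1_singleton_iff)
    have nv: "n \<in> nbr E v" using n \<open>M \<subseteq> nbr E v\<close> by auto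
    have "branches n (nbr E n - {v}) \<subseteq> branches v N"
      using branch_child[OF nv] n node.hyps(1) unfolding branches_def by blast
    moreover have "\<exists>v' M. M \<subseteq> nbr E v' \<and> 2 \<le> card M \<and>
        branches v' M \<subseteq> branches n (nbr E n - {v}) \<and>
        (\<forall>n\<in>M. branching E n (nbr E n - {v'}) (Suc k - card M))"
      using node.IH[of n] n node.prems by auto
    ultimately show ?thesis by (meson order_trans)
  next
    case 2
    have "branches v M \<subseteq> branches v N" using node.hyps(1) by (auto simp: branches_def)
    then show ?thesis using 2 node.hyps(3) \<open>M \<subseteq> nbr E v\<close> by blast
  qed
qed simp

subsection \<open>The strategy of the oracle\<close>

text \<open>A vertex of an unfilled branch can only be forced from outside the branch, hence from
  \<open>v\<close>; but then \<open>v\<close> sees two unfilled roots inside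
  \<open>W\<close>.\<close>

lemma fill_step_avoids:
  assumes step: "fill_step E W F F'" and L: "branches v M \<inter> F = {}" and M: "M \<subseteq> nbr E v"
    and W: "branches v M \<inter> W = {} \<or> (\<exists>a\<in>M \<inter> W. \<exists>b\<in>M \<inter> W. a \<noteq> b)"
  shows "branches v M \<inter> F' = {}"
proof -
  obtain y u where yu: "y \<in> F" "y \<in> W" "{x \<in> W. {y, x} \<in> E} - F = {u}" "F' = insert u F"
    using step by (auto simp: fill_step_def)
  have u: "u \<in> W" "{y, u} \<in> E" using yu by auto
  have "u \<notin> branches v M"
  proof
    assume uL: "u \<in> branches v M"
    then obtain n where n: "n \<in> M" "u \<in> branch v n" by (auto simp: branches_def)
    have "y \<notin> branch v n" using L yu(1) n by (auto simp: branches_def)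
    then have y: "y = v" using branch_adj[of u v n y] n u(2) M by (auto simp: insert_commute)
    obtain a b where ab: "a \<in> M \<inter> W" "b \<in> M \<inter> W" "a \<noteq> b" using W uL u by auto
    then have "a \<notin> F" "b \<notin> F" using L branch_self unfolding branches_def by blast+
    then have "a \<in> {u}" "b \<in> {u}" using ab y M unfolding yu(3)[symmetric] by (auto simp: nbr_def)
    then show False using ab by simp
  qed
  then show ?thesis using L yu by auto
qed

lemma fill_steps_avoid:
  assumes "(fill_step E W)\<^sup>*\<^sup>* F F'" "branches v M \<inter> F = {}" "M \<subseteq> nbr E v"
    "branches v M \<inter> W = {} \<or> (\<exists>a\<in>M \<inter> W. \<exists>b\<in>M \<inter> W. a \<noteq> b)"
  shows "branches v M \<inter> F' = {}"
  using assms(1,2) by (induction rule: rtranclp_induct) (use fill_step_avoids assms(3,4) in blast)+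

text \<open>If some selected component misses the branches, it is returned alone. Otherwise each
  contains the root of a branch, because branches are connected and wholly unfilled; two components
  supply two roots, and the whole selection is returned.\<close>

lemma oracle_answer:
  assumes S: "S \<subseteq> components E (V - F)" "2 \<le> card S"
    and L: "branches v M \<inter> F = {}" and M: "M \<subseteq> nbr E v"
  shows "\<exists>T. T \<subseteq> S \<and> T \<noteq> {} \<and> (branches v M \<inter> (F \<union> \<Union>T) = {} \<or>
    (\<exists>a\<in>M \<inter> (F \<union> \<Union>T). \<exists>b\<in>M \<inter> (F \<union> \<Union>T). a \<noteq> b))"
proof (cases "\<exists>C\<in>S. branches v M \<inter> C = {}")
  case True
  then obtain C where "C \<in> S" "branches v M \<inter> C = {}" by auto
  then show ?thesis using L by (intro exI[of _ "{C}"]) auto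
next
  case False
  have root: "\<exists>n\<in>M. \<exists>x\<in>V - F. n \<in> C \<and> C = {y. (adj_in E (V - F))\<^sup>*\<^sup>* n y}" if C: "C \<in> S" for C
  proof -
    obtain x where x: "x \<in> V - F" "C = {y. (adj_in E (V - F))\<^sup>*\<^sup>* x y}"
      using C S(1) unfolding components_def by blast
    obtain n y where n: "n \<in> M" "y \<in> branch v n" "y \<in> C"
      using False C unfolding branches_def by blast
    have "branch v n \<subseteq> V - F"
      using L branch_subset[of n v] n M by (auto simp: branches_def)
    then have "(adj_in E (V - F))\<^sup>*\<^sup>* n y" using branch_connected n M by blast
    moreover have "(adj_in E (V - F))\<^sup>*\<^sup>* x y" using n x by simp
    ultimately have "(adj_in E (V - F))\<^sup>*\<^sup>* n x" "(adj_in E (V - F))\<^sup>*\<^sup>* x n"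
      by (meson rtranclp_adj_in_sym rtranclp_trans)+
    then have "C = {y. (adj_in E (V - F))\<^sup>*\<^sup>* n y}" using x(2) by (auto intro: rtranclp_trans)
    then show ?thesis using n x(1) by auto
  qed
  obtain C D where CD: "C \<in> S" "D \<in> S" "C \<noteq> D"
    using S(2) by (rule two_elements)
  obtain a where a: "a \<in> M" "a \<in> C" "C = {y. (adj_in E (V - F))\<^sup>*\<^sup>* a y}"
    using root[OF CD(1)] by blast
  obtain b where b: "b \<in> M" "b \<in> D" "D = {y. (adj_in E (V - F))\<^sup>*\<^sup>* b y}"
    using root[OF CD(2)] by blast
  have "a \<noteq> b" using CD(3) unfolding a(3) b(3) by blast
  moreover have "a \<in> M \<inter> (F \<union> \<Union>S)" "b \<in> M \<inter> (F \<union> \<Union>S)" using CD(1,2) a(1,2) b(1,2) by blast+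
  moreover have "S \<noteq> {}" using CD(1) by blast
  ultimately show ?thesis by blast
qed

text \<open>The invariant of the oracle: the branches in \<open>M\<close> are unfilled and witness
  value \<open>k + 1\<close> at \<open>v\<close>, one more than the tokens left. The number
  \<open>k + 2 - card M\<close> is the threshold of \<open>branching.node\<close> for that
  value.\<close>

lemma zq_win_lower:
  assumes "zq_win 1 V E k F"
  shows "M \<subseteq> nbr E v \<Longrightarrow> 2 \<le> card M \<Longrightarrow> branches v M \<inter> F = {} \<Longrightarrow>
    (\<And>n. n \<in> M \<Longrightarrow> branching E n (nbr E n - {v}) (k + 2 - card M)) \<Longrightarrow> False"
  using assms
proof (induction arbitrary: v M rule: zq_win.induct)
  case (finished F k)
  then obtain n where "n \<in> M" by fastforce
  then have "n \<in> branches v M \<inter> F" using finished.hyps finished.prems(1) nbr_in[of n v] branch_self[of n v]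
    unfolding branches_def by blast
  then show ?case using finished.prems(3) by blast
next
  case (token u F k)
  have finM: "finite M" using token.prems(1) finite_nbr by (rule finite_subset)
  have "\<exists>n0\<in>M. \<forall>n\<in>M. u \<in> branch v n \<longrightarrow> n = n0"
  proof (cases "\<exists>n\<in>M. u \<in> branch v n")
    case True
    then show ?thesis using branch_disjoint token.prems(1) by blast
  next
    case False
    have "M \<noteq> {}" using token.prems(2) by auto
    then show ?thesis using False by blast
  qed
  then obtain n0 where n0: "n0 \<in> M" "\<And>n. n \<in> M \<Longrightarrow> u \<in> branch v n \<Longrightarrow> n = n0" by blast
  define M' where "M' = M - {n0}"
  have card: "card M = Suc (card M')" unfolding M'_def using finM n0(1) by (rule card.remove)
  have L': "branches v M' \<inter> insert u F = {}"
    using token.prems(3) n0(2) by (auto simp: branches_def M'_def)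
  have nbr': "M' \<subseteq> nbr E v" using token.prems(1) by (auto simp: M'_def)
  \<comment> \<open>One token and one branch fewer cancel, so the remaining branches keep their
    thresholds.\<close>
  have br': "branching E n (nbr E n - {v}) (k + 2 - card M')" if "n \<in> M'" for n
    using token.prems(4)[of n] that card by (simp add: M'_def)
  show False
  proof (cases "2 \<le> card M'")
    case True
    show ?thesis by (rule token.IH[OF nbr' True L' br'])
  next
    case False
    \<comment> \<open>A lone branch has value \<open>Suc k\<close>, so the oracle moves into it,
      down to a vertex with two branches.\<close>
    then have "card M' = 1" using card token.prems(2) by simp
    then obtain n where n: "M' = {n}" by (auto simp: card_1_singleton_iff)
    then have "branching E v M' (Suc k)" 
      using branching_child[of E n v "Suc k" M'] br'[of n] by simp
    then obtain v' N where N: "N \<subseteq> nbr E v'" "2 \<le> card N" "branches v' N \<subseteq> branches v M'"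
      "\<forall>n\<in>N. branching E n (nbr E n - {v'}) (Suc (Suc k) - card N)"
      using branchingE_two[of v M' "Suc k"] nbr' by auto
    show ?thesis by (rule token.IH[OF N(1,2)]) (use N L' in auto)
  qed
next
  case (force F F' k)
  have "2 \<le> card M" by fact
  then obtain a b where "a \<in> M" "b \<in> M" "a \<noteq> b" by (rule two_elements)
  then have "\<exists>a\<in>M \<inter> V. \<exists>b\<in>M \<inter> V. a \<noteq> b" using force.prems(1) nbr_in by blast
  then have "branches v M \<inter> F' = {}"
    using fill_step_avoids[OF force(1)] force.prems by blast
  then show ?case using force.IH[OF force.prems(1,2)] force.prems(4) by blast
next
  case (query S F k)
  obtain T where T: "T \<subseteq> S" "T \<noteq> {}" "branches v M \<inter> (F \<union> \<Union>T) = {} \<or>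
    (\<exists>a\<in>M \<inter> (F \<union> \<Union>T). \<exists>b\<in>M \<inter> (F \<union> \<Union>T). a \<noteq> b)"
    using oracle_answer[of S F v M] query by auto
  then obtain F' where F': "(fill_step E (F \<union> \<Union>T))\<^sup>*\<^sup>* F F'"
    "\<And>v M. M \<subseteq> nbr E v \<Longrightarrow> 2 \<le> card M \<Longrightarrow> branches v M \<inter> F' = {} \<Longrightarrow>
      (\<And>n. n \<in> M \<Longrightarrow> branching E n (nbr E n - {v}) (k + 2 - card M)) \<Longrightarrow> False"
    using query(3) by meson
  have "branches v M \<inter> F' = {}"
    using fill_steps_avoid[OF F'(1)] T(3) query.prems by blast
  then show ?case using F'(2) query.prems by blast
qed

lemma zq_win_not_branching:
  assumes "zq_win 1 V E k {}" "v \<in> V"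
  shows "\<not> branching E v (nbr E v) (Suc k)"
proof
  assume "branching E v (nbr E v) (Suc k)"
  then obtain v' M where "M \<subseteq> nbr E v'" "2 \<le> card M"
    "\<forall>n\<in>M. branching E n (nbr E n - {v'}) (Suc (Suc k) - card M)"
    using branchingE_two[of v "nbr E v" "Suc k"] by auto
  then show False using zq_win_lower[OF assms(1), of M v'] by auto
qed

subsection \<open>Placing a token\<close>

definition free :: "'a set \<Rightarrow> 'a \<Rightarrow> 'a set" where
  "free F v = {n \<in> nbr E v. branch v n \<inter> F = {}}"

text \<open>Every position the oracle can reach from \<open>F\<close> in which the unfilled set is a union of branches
  at one vertex has value at most \<open>k\<close>.\<close>

definition good :: "'a set \<Rightarrow> nat \<Rightarrow> bool" where
  "good F k \<longleftrightarrow> (\<forall>v\<in>V. \<not> branching E v (free F v) (Suc k))"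

section \<open>Monotonicity of values and their transport towards a root\<close>

lemma free_subset: "free F v \<subseteq> nbr E v"
  by (auto simp: free_def)

lemma free_antimono: "F \<subseteq> F' \<Longrightarrow> free F' v \<subseteq> free F v"
  by (auto simp: free_def)

lemma good_mono: "good F k \<Longrightarrow> F \<subseteq> F' \<Longrightarrow> good F' k"
  unfolding good_def by (meson branching_mono free_antimono)

lemma branch_psubset:
  assumes "n \<in> nbr E v" "m \<in> nbr E n" "m \<noteq> v"
  shows "card (branch n m) < card (branch v n)"
proof (rule psubset_card_mono)
  show "finite (branch v n)" using branch_subset[OF assms(1)] finite_subset by fastforce
  show "branch n m \<subset> branch v n" using branch_child[OF assms] branch_self[of n v] by blast
qed

text \<open>With the tree rooted at \<open>x\<close>, \<open>u\<close> is the parent of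
  \<open>v\<close>. The value of what hangs below \<open>v\<close> is carried up to \<open>m\<close>
  one ancestor at a time by \<open>branching_child\<close>.\<close>

lemma parent:
  assumes "m \<in> nbr E x" "v \<in> branch x m"
  shows "\<exists>u. u \<in> nbr E v \<and> V - branch x m \<subseteq> branch v u \<and>
    (\<forall>k. branching E v (nbr E v - {u}) k \<longrightarrow> branching E m (nbr E m - {x}) k)"
  using assms
proof (induction "card (branch x m)" arbitrary: x m rule: less_induct)
  case less
  show ?case
  proof (cases "v = m")
    case True
    then show ?thesis
      using nbr_sym[OF less.prems(1)] branch_compl[OF less.prems(1)] by (intro exI[of _ x]) simp
  next
    case False
    obtain n where n: "n \<in> nbr E m" "n \<noteq> x" "v \<in> branch m n"
      by (rule branch_cases[OF less.prems False])
    then obtain u where "u \<in> nbr E v" "V - branch m n \<subseteq> branch v u"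
      "\<forall>k. branching E v (nbr E v - {u}) k \<longrightarrow> branching E n (nbr E n - {m}) k"
      using less.hyps[of m n] branch_psubset less.prems by meson
    moreover have "branch m n \<subseteq> branch x m" using branch_child[OF less.prems(1) n(1,2)] by auto
    moreover have "n \<in> nbr E m - {x}" using n by simp
    ultimately show ?thesis by (meson Diff_mono branching_child order_refl subset_trans)
  qed
qed

text \<open>The filled vertex \<open>w\<close> lies behind the parent of \<open>v\<close>, so that
  side is not free and the value at \<open>v\<close> comes from its descendants only.\<close>

lemma branching_up:
  assumes "m \<in> nbr E x" "v \<in> branch x m" "w \<in> F" "w \<in> V" "w \<notin> branch x m"
    "branching E v (free F v) k"
  shows "branching E m (nbr E m - {x}) k"
proof -
  obtain u where u: "u \<in> nbr E v" "V - branch x m \<subseteq> branch v u"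
    "\<forall>k. branching E v (nbr E v - {u}) k \<longrightarrow> branching E m (nbr E m - {x}) k"
    using parent[OF assms(1,2)] by blast
  have "w \<in> branch v u" using u(2) assms(4,5) by blast
  then have "free F v \<subseteq> nbr E v - {u}" using assms(3) by (auto simp: free_def)
  then show ?thesis using u(3) branching_mono[OF assms(6)] by blast
qed

text \<open>The branch towards the parent contains \<open>w\<close>, and every other neighbor of
  \<open>v\<close> lies in the filled set \<open>branch x m\<close>.\<close>

lemma free_in_filled:
  assumes "m \<in> nbr E x" "v \<in> branch x m" "w \<in> F" "w \<in> V" "w \<notin> branch x m" "branch x m \<subseteq> F"
  shows "free F v = {}"
proof -
  obtain u where u: "u \<in> nbr E v" "V - branch x m \<subseteq> branch v u"
    using parent[OF assms(1,2)] by blast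
  have "n \<notin> free F v" for n
  proof
    assume n: "n \<in> free F v"
    have "w \<in> branch v u" using u(2) assms(4,5) by blast
    then have "n \<noteq> u" "n \<in> nbr E v" using n assms(3) by (auto simp: free_def)
    then have "n \<notin> branch v u" "n \<in> V" using branch_nbr_eq[of u v n] u(1) nbr_in by auto
    then have "n \<in> F" using u(2) assms(6) by auto
    then show False using n branch_self[of n v] unfolding free_def by blast
  qed
  then show ?thesis by auto
qed

lemma children_free:
  assumes "x \<in> nbr E p" "branch p x \<inter> F = {}"
  shows "nbr E x - {p} \<subseteq> free F x"
  using branch_child[OF assms(1)] assms(2) by (auto simp: free_def)

text \<open>One step of the walk that places a token: it has arrived at \<open>x\<close> from \<open>p\<close> and stops there
  if the value at \<open>x\<close> is already below \<open>k\<close>.\<close>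

lemma token_in_branch:
  assumes "good F k" "k > 0" "x \<in> nbr E p" "branch p x \<inter> F = {}"
    "\<not> branching E p (free F p - {x}) k"
  shows "\<exists>w\<in>branch p x. \<forall>v\<in>branch p x. \<not> branching E v (free (insert w F) v) k"
  using assms(3-)
proof (induction "card (branch p x)" arbitrary: p x rule: less_induct)
  case less
  have xV: "x \<in> V" using nbr_in less.prems(1) by auto
  \<comment> \<open>Value \<open>k\<close> at a vertex \<open>v\<close> strictly below
    \<open>x\<close> climbs to \<open>x\<close> when the token \<open>w\<close> is outside the child
    branch of \<open>v\<close>; if that branch is not \<open>y\<close>, the value survives the
    removal of \<open>y\<close>.\<close>
  have below: "branching E x (free F x - {y}) k"
    if h: "v \<in> branch p x" "w \<in> V" "v \<noteq> x" "branching E v (free (insert w F) v) k"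
      "\<And>m. m \<in> nbr E x \<Longrightarrow> v \<in> branch x m \<Longrightarrow> w \<notin> branch x m \<and> m \<noteq> y" for v w y
  proof -
    obtain m where m: "m \<in> nbr E x" "m \<noteq> p" "v \<in> branch x m"
      by (rule branch_cases[OF less.prems(1) h(1,3)])
    then have "branching E m (nbr E m - {x}) k"
      using branching_up[OF m(1,3) _ h(2) _ h(4)] h(5)[OF m(1,3)] by blast
    moreover have "m \<in> free F x - {y}" using children_free[OF less.prems(1,2)] m(1,2) h(5)[OF m(1,3)] by blast
    ultimately show ?thesis by (rule branching_child)
  qed
  show ?case
  proof (cases "branching E x (free F x) k")
    case False
    have "\<not> branching E v (free (insert x F) v) k" if v: "v \<in> branch p x" for v
    proof
      assume br: "branching E v (free (insert x F) v) k"
      show False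
      proof (cases "v = x")
        case True
        then show ?thesis
          using False branching_mono[OF br] free_antimono[of F "insert x F"] by blast
      next
        case ne: False
        have "x \<notin> branch x m \<and> m \<noteq> x" if "m \<in> nbr E x" for m
          using that branch_subset[of m x] nbr_in[of m x] by auto
        then have "branching E x (free F x - {x}) k" using below[OF v xV ne br] by blast
        from branching_mono[OF this] show False using False by blast
      qed
    qed
    then show ?thesis by (intro bexI[of _ x]) auto
  next
    case True
    \<comment> \<open>This keeps the walk from turning back: otherwise all branches at
      \<open>p\<close> other than \<open>x\<close> would be free and have value \<open>k\<close>,
      against the hypothesis on \<open>p\<close>.\<close>
    have "\<not> (p \<in> free F x \<and> branching E p (nbr E p - {x}) k)"
    proof
      assume p: "p \<in> free F x \<and> branching E p (nbr E p - {x}) k"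
      then have "nbr E p - {x} \<subseteq> free F p - {x}"
        using children_free[of p x F] by (auto simp: free_def)
      then show False using less.prems(3) branching_mono[of E p "nbr E p - {x}" k] p by blast
    qed
    \<comment> \<open>The failure of value \<open>k\<close> after removing \<open>y\<close> is
      exactly the hypothesis needed for the next step, from \<open>x\<close> to
      \<open>y\<close>.\<close>
    then obtain y where y: "y \<in> free F x" "y \<noteq> p" "\<not> branching E x (free F x - {y}) k"
      using branching_remove[of "free F x" k E x p] True assms(1,2) xV
        finite_subset[OF free_subset finite_nbr] unfolding good_def by metis
    have yn: "y \<in> nbr E x" "branch x y \<inter> F = {}" using y(1) by (auto simp: free_def)
    obtain w where w: "w \<in> branch x y" "\<forall>v\<in>branch x y. \<not> branching E v (free (insert w F) v) k"
      using less.hyps[OF branch_psubset[OF less.prems(1) yn(1) y(2)] yn y(3)] by auto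
    have wp: "w \<in> branch p x" using w(1) branch_child[OF less.prems(1) yn(1) y(2)] by auto
    then have wV: "w \<in> V" using branch_subset less.prems(1) by auto
    have "\<not> branching E v (free (insert w F) v) k" if v: "v \<in> branch p x" for v
    proof
      assume br: "branching E v (free (insert w F) v) k"
      \<comment> \<open>At \<open>x\<close> the token removes \<open>y\<close> from the free
        branches; inside \<open>branch x y\<close> the induction applies; elsewhere the value would
        climb to \<open>x\<close> through a branch other than \<open>y\<close>.\<close>
      consider "v = x" | "v \<in> branch x y" | "v \<noteq> x" "v \<notin> branch x y" by auto
      then show False
      proof cases
        case 1
        have "free (insert w F) x \<subseteq> free F x - {y}" using w(1) by (auto simp: free_def)
        then show ?thesis using branching_mono[OF br] y(3) 1 by blast
      next
        case 2
        then show ?thesis using w br by auto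
      next
        case 3
        have "w \<notin> branch x m \<and> m \<noteq> y" if "m \<in> nbr E x" "v \<in> branch x m" for m
          using that 3(2) branch_disjoint[OF yn(1) that(1) w(1)] by auto
        then show ?thesis using below[OF v wV 3(1) br] y(3) by blast
      qed
    qed
    then show ?thesis using wp by auto
  qed
qed

text \<open>Starts the walk of \<open>token_in_branch\<close> at \<open>r\<close>. Leaving open
  whether \<open>r\<close> is filled covers both the opening move on the empty position and the
  later stuck positions.\<close>

lemma token_exists:
  assumes good: "good F (Suc k)" and r: "r \<in> V" "N0 \<subseteq> nbr E r"
    and L: "branches r N0 \<inter> F = {}" "V \<subseteq> F \<union> branches r N0 \<union> {r}"
  shows "\<exists>w\<in>V. good (insert w F) k"
proof -
  have out: "branch r n \<subseteq> F" if "n \<in> nbr E r" "n \<notin> N0" for n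
  proof
    fix y assume y: "y \<in> branch r n"
    then have "y \<in> V - {r}" using branch_subset that by blast
    moreover have "y \<notin> branches r N0"
      using y that branch_disjoint r(2) unfolding branches_def by blast
    ultimately show "y \<in> F" using L(2) by auto
  qed
  have free: "free F r = N0"
  proof
    show "free F r \<subseteq> N0" using out branch_self unfolding free_def by blast
    show "N0 \<subseteq> free F r" using L(1) r(2) by (auto simp: free_def branches_def)
  qed
  \<comment> \<open>If the branch of \<open>v\<close> is in \<open>N0\<close>, the value at
    \<open>v\<close> climbs to \<open>r\<close>; otherwise that branch is already filled and nothing
    is free at \<open>v\<close>.\<close>
  have outside: "branching E r (N0 - {y}) (Suc k)"
    if h: "n \<in> nbr E r" "v \<in> branch r n" "w \<in> V" "w \<notin> branch r n" "n \<noteq> y"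
      "branching E v (free (insert w F) v) (Suc k)" for n v w y
  proof (cases "n \<in> N0")
    case True
    have "branching E n (nbr E n - {r}) (Suc k)"
      using branching_up[OF h(1,2) _ h(3,4,6)] by blast
    then show ?thesis by (rule branching_child) (use True h(5) in simp)
  next
    case False
    then have "free (insert w F) v = {}"
      using free_in_filled[OF h(1,2) _ h(3,4)] out[OF h(1)] by blast
    then show ?thesis using h(6) not_branching_empty[of E v "Suc k"] by simp
  qed
  show ?thesis
  proof (cases "branching E r N0 (Suc k)")
    case False
    have "\<not> branching E v (free (insert r F) v) (Suc k)" if v: "v \<in> V" for v
    proof
      assume br: "branching E v (free (insert r F) v) (Suc k)"
      show False
      proof (cases "v = r")
        case True
        then show ?thesis
          using False branching_mono[OF br] free_antimono[of F "insert r F"] free by blast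
      next
        case ne: False
        obtain n where n: "n \<in> nbr E r" "v \<in> branch r n" by (rule vertex_cases[OF r(1) v ne])
        have "branching E r (N0 - {r}) (Suc k)"
          using outside[OF n r(1) _ _ br, of r] branch_subset[OF n(1)] nbr_in[OF n(1)] by blast
        from branching_mono[OF this] show False using False by blast
      qed
    qed
    then show ?thesis using r(1) by (auto simp: good_def)
  next
    case True
    \<comment> \<open>The walk has no previous vertex here; \<open>r\<close>, not being its own
      neighbor, stands in for \<open>p\<close> in \<open>branching_remove\<close>.\<close>
    have "r \<notin> N0" using r(2) nbr_in by blast
    then have r': "\<not> (r \<in> N0 \<and> branching E r (nbr E r - {r}) (Suc k))" by simp
    have "\<not> branching E r N0 (Suc (Suc k))" using good r(1) free by (auto simp: good_def)
    then obtain y where y: "y \<in> N0" "\<not> branching E r (N0 - {y}) (Suc k)"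
      by (rule branching_remove[OF finite_subset[OF r(2) finite_nbr] zero_less_Suc _ True r'])
    have yn: "y \<in> nbr E r" "branch r y \<inter> F = {}" using y(1) free by (auto simp: free_def)
    obtain w where w: "w \<in> branch r y"
      "\<forall>v\<in>branch r y. \<not> branching E v (free (insert w F) v) (Suc k)"
      using token_in_branch[OF good _ yn] y(2) free by auto
    have wV: "w \<in> V" using branch_subset yn(1) w(1) by blast
    have "\<not> branching E v (free (insert w F) v) (Suc k)" if v: "v \<in> V" for v
    proof
      assume br: "branching E v (free (insert w F) v) (Suc k)"
      show False
      proof (cases "v = r")
        case True
        have "free (insert w F) r \<subseteq> N0 - {y}" using w(1) by (auto simp: free_def simp flip: free)
        then show ?thesis using branching_mono[OF br] y(2) True by blast
      next
        case False
        obtain n where n: "n \<in> nbr E r" "v \<in> branch r n"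
          by (rule vertex_cases[OF r(1) v False])
        show ?thesis
        proof (cases "n = y")
          case True
          then show ?thesis using n w(2) br by auto
        next
          case False
          then have "w \<notin> branch r n" using branch_disjoint[OF yn(1) n(1) w(1)] by auto
          then show ?thesis using outside[OF n wV _ False br] y(2) by auto
        qed
      qed
    qed
    then show ?thesis using wV by (auto simp: good_def)
  qed
qed

subsection \<open>The strategy of the player\<close>

lemma component_sub_branch:
  assumes "C \<in> components E (V - F)" "u \<in> F" "m \<in> nbr E u" "c \<in> C" "c \<in> branch u m"
  shows "C \<subseteq> branch u m"
proof
  fix d assume d: "d \<in> C"
  obtain x where x: "C = {y. (adj_in E (V - F))\<^sup>*\<^sup>* x y}"
    using assms(1) unfolding components_def by blast
  have "(adj_in E (V - F))\<^sup>*\<^sup>* c x"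
    using assms(4) rtranclp_adj_in_sym[of E "V - F" x c] by (simp add: x)
  moreover have "(adj_in E (V - F))\<^sup>*\<^sup>* x d" using d by (simp add: x)
  ultimately have "(adj_in E (V - F))\<^sup>*\<^sup>* c d" by (rule rtranclp_trans)
  then show "d \<in> branch u m" by (rule connected_sub_branch) (use assms in auto)
qed

lemma component_subset:
  assumes "C \<in> components E U"
  shows "C \<subseteq> U" "C \<noteq> {}"
proof -
  obtain x where x: "x \<in> U" "C = {y. (adj_in E U)\<^sup>*\<^sup>* x y}"
    using assms unfolding components_def by blast
  show "C \<noteq> {}" unfolding x(2) by blast
  show "C \<subseteq> U"
  proof
    fix y assume "y \<in> C"
    then have "(adj_in E U)\<^sup>*\<^sup>* x y" by (simp add: x(2))
    then show "y \<in> U" by (cases rule: rtranclp.cases) (use x(1) in \<open>auto simp: adj_in_def\<close>)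
  qed
qed

lemma component_of:
  assumes "x \<in> U"
  obtains C where "C \<in> components E U" "x \<in> C"
proof
  show "{y. (adj_in E U)\<^sup>*\<^sup>* x y} \<in> components E U" using assms unfolding components_def by blast
qed simp

lemma component_closed:
  assumes "C \<in> components E U" "x \<in> C" "{x, y} \<in> E" "y \<in> U"
  shows "y \<in> C"
proof -
  obtain z where z: "C = {y. (adj_in E U)\<^sup>*\<^sup>* z y}"
    using assms(1) unfolding components_def by blast
  have "adj_in E U x y" using assms component_subset[OF assms(1)] by (auto simp: adj_in_def)
  moreover have "(adj_in E U)\<^sup>*\<^sup>* z x" using assms(2) by (simp add: z)
  ultimately have "(adj_in E U)\<^sup>*\<^sup>* z y" by (rule rtranclp.rtrancl_into_rtrancl[rotated])
  then show ?thesis by (simp add: z)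
qed

lemma component_eq:
  assumes "C \<in> components E U" "D \<in> components E U" "x \<in> C" "x \<in> D"
  shows "C = D"
proof -
  have "C \<subseteq> D" if CD: "C \<in> components E U" "D \<in> components E U" "x \<in> C" "x \<in> D" for C D
  proof
    fix y assume y: "y \<in> C"
    obtain c where c: "C = {y. (adj_in E U)\<^sup>*\<^sup>* c y}" using CD(1) unfolding components_def by blast
    obtain d where d: "D = {y. (adj_in E U)\<^sup>*\<^sup>* d y}" using CD(2) unfolding components_def by blast
    have "(adj_in E U)\<^sup>*\<^sup>* d x" using CD(4) by (simp add: d)
    also have "(adj_in E U)\<^sup>*\<^sup>* x c"
      using CD(3) rtranclp_adj_in_sym[of E U c x] by (simp add: c)
    also have "(adj_in E U)\<^sup>*\<^sup>* c y" using y by (simp add: c)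
    finally show "y \<in> D" by (simp add: d)
  qed
  then show ?thesis using assms by blast
qed

text \<open>Two neighbors of \<open>u\<close> lie in different branches at \<open>u\<close>, while a
  component avoiding \<open>u\<close> stays in one branch.\<close>

lemma component_one_nbr:
  assumes "C \<in> components E (V - F)" "u \<in> F" "c \<in> C" "d \<in> C" "{u, c} \<in> E" "{u, d} \<in> E"
  shows "d = c"
proof -
  have "c \<in> nbr E u" "d \<in> nbr E u" using assms by (auto simp: nbr_def)
  then show ?thesis
    using component_sub_branch[OF assms(1,2) _ assms(3), of c] assms(4) branch_nbr_eq by auto
qed

lemma crossing:
  assumes "(adj_in E W)\<^sup>*\<^sup>* a b" "a \<in> A" "b \<notin> A"
  obtains x y where "x \<in> A" "y \<notin> A" "x \<in> W" "y \<in> W" "{x, y} \<in> E"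
proof -
  have "b \<in> A \<or> (\<exists>x y. x \<in> A \<and> y \<notin> A \<and> adj_in E W x y)"
    using assms(1,2) by (induction rule: rtranclp_induct) auto
  then show ?thesis using that assms(3) by (auto simp: adj_in_def)
qed

lemma component_boundary:
  assumes "C \<in> components E (V - F)" "F \<subseteq> V" "F \<noteq> {}"
  obtains c u where "c \<in> C" "u \<in> F" "{u, c} \<in> E"
proof -
  obtain a where a: "a \<in> C" using component_subset[OF assms(1)] by blast
  obtain b where b: "b \<in> F" using assms(3) by blast
  have "a \<in> V" "b \<in> V" "b \<notin> C" using component_subset[OF assms(1)] a b assms(2) by auto
  then have "(adj_in E V)\<^sup>*\<^sup>* a b" using tree by (auto simp: is_tree_def connected_graph_def)
  then obtain x y where xy: "x \<in> C" "y \<notin> C" "y \<in> V" "{x, y} \<in> E"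
    using crossing[of V a b C] a \<open>b \<notin> C\<close> by metis
  then have "y \<in> F" using component_closed[OF assms(1), of x y] by blast
  then show ?thesis using that[of x y] xy by (simp add: insert_commute)
qed

lemma component_force:
  assumes "C \<in> components E (V - F)" "u \<in> F" "c \<in> C" "{u, c} \<in> E" "C \<in> T"
    and "\<And>D d. D \<in> T \<Longrightarrow> D \<noteq> C \<Longrightarrow> d \<in> D \<Longrightarrow> {u, d} \<notin> E"
  shows "fill_step E (F \<union> \<Union>T) F (insert c F)"
proof -
  have "c \<notin> F" using component_subset[OF assms(1)] assms(3) by blast
  then have "{x \<in> F \<union> \<Union>T. {u, x} \<in> E} - F = {c}"
    using component_one_nbr[OF assms(1,2,3) _ assms(4)] assms(3-6) by blast
  then show ?thesis using assms(2) unfolding fill_step_def by blast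
qed

text \<open>The last two hypotheses exclude free progress: no forcing in the whole graph, and no two
  components without a common filled neighbor, for which a query would help. Any filled vertex next
  to an unfilled one can then serve as \<open>r\<close>.\<close>

lemma stuck:
  assumes F: "F \<subseteq> V" "F \<noteq> {}" "F \<noteq> V"
    and no_force: "\<And>F'. \<not> fill_step E V F F'"
    and linked: "\<And>C D. C \<in> components E (V - F) \<Longrightarrow> D \<in> components E (V - F) \<Longrightarrow> C \<noteq> D \<Longrightarrow>
      \<exists>u\<in>F. (\<exists>c\<in>C. {u, c} \<in> E) \<and> (\<exists>d\<in>D. {u, d} \<in> E)"
  shows "\<exists>r\<in>F. \<exists>N. N \<subseteq> nbr E r \<and> 2 \<le> card N \<and> branches r N = V - F"
proof -
  have second: "\<exists>n'\<in>V - F. {u, n'} \<in> E \<and> n' \<noteq> n"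
    if "u \<in> F" "n \<in> V - F" "{u, n} \<in> E" for u n
  proof (rule ccontr)
    assume "\<not> ?thesis"
    then have "{x \<in> V. {u, x} \<in> E} - F = {n}" using that by blast
    then have "fill_step E V F (insert n F)" using that F(1) unfolding fill_step_def by blast
    then show False using no_force by blast
  qed
  obtain b where "b \<in> V - F" using F by blast
  then obtain C0 where C0: "C0 \<in> components E (V - F)" by (rule component_of)
  obtain n u where nu: "n \<in> C0" "u \<in> F" "{u, n} \<in> E" by (rule component_boundary[OF C0 F(1,2)])
  have n: "n \<in> V - F" using component_subset[OF C0] nu(1) by blast
  obtain n' where n': "n' \<in> V - F" "{u, n'} \<in> E" "n' \<noteq> n" using second[OF nu(2) n nu(3)] by blast
  define N where "N = nbr E u - F"
  have nN: "n \<in> N" "n' \<in> N" using n n' nu by (auto simp: N_def nbr_def)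
  have "card {n, n'} \<le> card N" by (rule card_mono) (use nN in \<open>auto simp: N_def\<close>)
  then have N2: "2 \<le> card N" using n'(3) by simp
  have uV: "u \<in> V" using nu F by blast
  have comp: "\<exists>C\<in>components E (V - F). y \<in> C \<and> C \<subseteq> branch u m"
    if "m \<in> nbr E u" "y \<in> branch u m" "y \<notin> F" for y m
  proof -
    have "y \<in> V - F" using that branch_subset by blast
    then obtain C where "C \<in> components E (V - F)" "y \<in> C" by (rule component_of)
    then show ?thesis using component_sub_branch[OF _ nu(2) that(1) _ that(2)] by blast
  qed
  \<comment> \<open>A filled vertex linking components in two branches at \<open>u\<close> must be
    \<open>u\<close> itself, so each of them contains the root of its branch.\<close>
  have adj: "m1 \<in> C"
    if h: "m1 \<in> nbr E u" "m2 \<in> nbr E u" "m1 \<noteq> m2" "C \<subseteq> branch u m1" "D \<subseteq> branch u m2"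
      "C \<in> components E (V - F)" "D \<in> components E (V - F)" for m1 m2 C D
  proof -
    have "C \<noteq> D"
      using branch_disjoint[OF h(1,2)] component_subset[OF h(6)] h(3-5) by blast
    then obtain t c d where t: "t \<in> F" "c \<in> C" "{t, c} \<in> E" "d \<in> D" "{t, d} \<in> E"
      using linked h(6,7) by meson
    have "t = u"
    proof (rule ccontr)
      assume "t \<noteq> u"
      then have "t \<in> branch u m1" "t \<in> branch u m2"
        using branch_adj[of c u m1 t] branch_adj[of d u m2 t] t h by (auto simp: insert_commute)
      then show False using branch_disjoint[OF h(1,2)] h(3) by blast
    qed
    then have "c = m1" using branch_nbr_eq[OF h(1), of c] t h(4) by (auto simp: nbr_def)
    then show ?thesis using t by simp
  qed
  \<comment> \<open>A walk from \<open>m\<close> to a filled vertex leaves the component of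
    \<open>m\<close> at a filled \<open>z\<close>, which has a second unfilled neighbor
    \<open>y\<close>. By \<open>adj\<close>, applied with another branch, \<open>y\<close> is in the
    component of \<open>m\<close> too, but \<open>z\<close> has only one neighbor there.\<close>
  have unfilled: "branch u m \<inter> F = {}" if m: "m \<in> N" for m
  proof (rule ccontr)
    assume "branch u m \<inter> F \<noteq> {}"
    then obtain a where a: "a \<in> branch u m" "a \<in> F" by blast
    have mu: "m \<in> nbr E u" "m \<notin> F" using m by (auto simp: N_def)
    obtain C where C: "C \<in> components E (V - F)" "m \<in> C" "C \<subseteq> branch u m"
      using comp[OF mu(1) branch_self mu(2)] by blast
    have "(adj_in E (branch u m))\<^sup>*\<^sup>* m a" using branch_connected[OF a(1) mu(1)] by blast
    moreover have "a \<notin> C" using a(2) component_subset(1)[OF C(1)] by blast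
    ultimately obtain x z where xz: "x \<in> C" "z \<notin> C" "z \<in> branch u m" "{x, z} \<in> E"
      using crossing[of "branch u m" m a C] C(2) by metis
    have zF: "z \<in> F"
      using component_closed[OF C(1) xz(1,4)] xz(2,3) branch_subset[OF mu(1)] by blast
    have xF: "x \<in> V - F" using component_subset(1)[OF C(1)] xz(1) by blast
    have zx: "{z, x} \<in> E" using xz(4) by (simp add: insert_commute)
    obtain y where y: "y \<in> V - F" "{z, y} \<in> E" "y \<noteq> x" using second[OF zF xF zx] by blast
    have "y \<in> branch u m" using branch_adj[OF xz(3) y(2)] y(1) nu(2) mu(1) by blast
    then obtain D where D: "D \<in> components E (V - F)" "y \<in> D" "D \<subseteq> branch u m"
      using comp[OF mu(1)] y(1) by blast
    obtain m' where m': "m' \<in> N" "m' \<noteq> m" using nN n'(3) by metis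
    then obtain C' where C': "C' \<in> components E (V - F)" "C' \<subseteq> branch u m'"
      using comp[of m' m'] branch_self by (auto simp: N_def)
    have "m \<in> D"
      using adj[OF mu(1) _ _ D(3) C'(2) D(1) C'(1)] m' by (auto simp: N_def)
    then have "y \<in> C" using component_eq[OF C(1) D(1) C(2)] D(2) by blast
    then show False using component_one_nbr[OF C(1) zF xz(1) _ zx y(2)] y(3) by blast
  qed
  \<comment> \<open>An unfilled vertex behind a filled root \<open>m\<close> would, by
    \<open>adj\<close>, lie in a component containing \<open>m\<close>.\<close>
  have "y \<in> branches u N" if y: "y \<in> V - F" for y
  proof (rule ccontr)
    assume out: "y \<notin> branches u N"
    have "y \<in> V" "y \<noteq> u" using y nu(2) by auto
    then obtain m where m: "m \<in> nbr E u" "y \<in> branch u m" using vertex_cases[OF uV] by metis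
    then have mF: "m \<in> F" using out by (auto simp: N_def branches_def)
    obtain D where D: "D \<in> components E (V - F)" "D \<subseteq> branch u m" using comp[OF m] y by blast
    have nu': "n \<in> nbr E u" using nN by (simp add: N_def)
    obtain C where C: "C \<in> components E (V - F)" "C \<subseteq> branch u n"
      using comp[OF nu' branch_self] n by blast
    have "m \<in> D" using adj[OF m(1) nu' _ D(2) C(2) D(1) C(1)] mF n by blast
    then show False using mF component_subset(1)[OF D(1)] by blast
  qed
  moreover have "branches u N \<subseteq> V - F"
    using unfilled branch_subset unfolding branches_def N_def by blast
  ultimately have "branches u N = V - F" by blast
  moreover have "N \<subseteq> nbr E u" by (auto simp: N_def)
  ultimately show ?thesis using nu(2) N2 by blast
qed

text \<open>Free moves fill a vertex and preserve \<open>good\<close>, so they are taken while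
  possible. A stuck position has value at least 1, so a token is left, and
  \<open>token_exists\<close> places it so that the bound drops by one.\<close>

lemma good_wins:
  assumes "F \<subseteq> V" "F \<noteq> {}" "good F k"
  shows "zq_win 1 V E k F"
  using assms
proof (induction "card (V - F)" arbitrary: F k rule: less_induct)
  case less
  have IH: "zq_win 1 V E j (insert c F)" if c: "c \<in> V - F" "good (insert c F) j" for c j
  proof -
    have "card (V - insert c F) < card (V - F)"
      by (rule psubset_card_mono) (use c(1) in auto)
    then show ?thesis using less.hyps[of "insert c F" j] c less.prems(1) by simp
  qed
  have IHk: "zq_win 1 V E k (insert c F)" if c: "c \<in> V - F" for c
    using IH[OF c good_mono[OF less.prems(3)]] by blast
  show ?case
  proof (cases "F = V \<or> (\<exists>F'. fill_step E V F F')")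
    case True
    then show ?thesis
    proof
      assume "F = V"
      then show ?thesis by (rule zq_win.finished)
    next
      assume "\<exists>F'. fill_step E V F F'"
      then obtain F' where F': "fill_step E V F F'" by blast
      then obtain v c where c: "{x \<in> V. {v, x} \<in> E} - F = {c}" "F' = insert c F"
        by (auto simp: fill_step_def)
      have "c \<in> V - F" using c(1) by blast
      then show ?thesis using zq_win.force[OF F'] IHk c(2) by simp
    qed
  next
    case False
    show ?thesis
    proof (cases "\<exists>C\<in>components E (V - F). \<exists>D\<in>components E (V - F). C \<noteq> D \<and>
        \<not> (\<exists>u\<in>F. (\<exists>c\<in>C. {u, c} \<in> E) \<and> (\<exists>d\<in>D. {u, d} \<in> E))")
      case True
      then obtain C D where CD: "C \<in> components E (V - F)" "D \<in> components E (V - F)" "C \<noteq> D"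
        "\<And>u. u \<in> F \<Longrightarrow> (\<exists>c\<in>C. {u, c} \<in> E) \<Longrightarrow> \<not> (\<exists>d\<in>D. {u, d} \<in> E)" by meson
      show ?thesis
      \<comment> \<open>\<open>C\<close> and \<open>D\<close> have no common filled neighbor, so any
        returned component can be forced into from its boundary, even if both come back.\<close>
      proof (rule zq_win.query[of "{C, D}"])
        show "{C, D} \<subseteq> components E (V - F)" using CD by simp
        show "Suc 1 \<le> card {C, D}" using CD(3) by simp
        have step: "\<exists>F'. (fill_step E (F \<union> \<Union>T))\<^sup>*\<^sup>* F F' \<and> zq_win 1 V E k F'"
          if T: "T \<subseteq> {C, D}" "B \<in> T" "B \<in> {C, D}" for T B
        proof -
          have B: "B \<in> components E (V - F)" using T(3) CD by blast
          obtain c u where cu: "c \<in> B" "u \<in> F" "{u, c} \<in> E"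
            by (rule component_boundary[OF B less.prems(1,2)])
          have "fill_step E (F \<union> \<Union>T) F (insert c F)"
            by (rule component_force[OF B cu(2,1,3) T(2)]) (use T CD(4) cu in blast)
          moreover have "c \<in> V - F" using component_subset(1)[OF B] cu(1) by blast
          ultimately show ?thesis using IHk by blast
        qed
        show "\<forall>T. T \<subseteq> {C, D} \<and> T \<noteq> {} \<longrightarrow>
          (\<exists>F'. (fill_step E (F \<union> \<Union>T))\<^sup>*\<^sup>* F F' \<and> zq_win 1 V E k F')"
        proof (intro allI impI)
          fix T assume T: "T \<subseteq> {C, D} \<and> T \<noteq> {}"
          then obtain B where "B \<in> T" by blast
          then show "\<exists>F'. (fill_step E (F \<union> \<Union>T))\<^sup>*\<^sup>* F F' \<and> zq_win 1 V E k F'"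
            using step[of T B] T by (meson subsetD)
        qed
      qed
    next
      case linked: False
      have "\<exists>r\<in>F. \<exists>N. N \<subseteq> nbr E r \<and> 2 \<le> card N \<and> branches r N = V - F"
      proof (rule stuck[OF less.prems(1,2)])
        show "F \<noteq> V" "\<And>F'. \<not> fill_step E V F F'" using False by simp_all
        show "\<exists>u\<in>F. (\<exists>c\<in>C. {u, c} \<in> E) \<and> (\<exists>d\<in>D. {u, d} \<in> E)"
          if "C \<in> components E (V - F)" "D \<in> components E (V - F)" "C \<noteq> D" for C D
          using linked that by blast
      qed
      then obtain r N where rN: "r \<in> F" "N \<subseteq> nbr E r" "2 \<le> card N" "branches r N = V - F"
        by blast
      have rV: "r \<in> V" using rN(1) less.prems(1) by blast
      have "N \<subseteq> free F r" using rN(2,4) unfolding free_def branches_def by blast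
      then have "branching E r (free F r) 1" by (rule branching_mono[OF branching_one[OF rN(3)]])
      then have "k \<noteq> 0" using less.prems(3) rV unfolding good_def by (metis One_nat_def)
      then obtain j where j: "k = Suc j" by (cases k) auto
      have "\<exists>w\<in>V. good (insert w F) j"
        by (rule token_exists[OF less.prems(3)[unfolded j] rV rN(2)]) (use rN(4) in auto)
      then obtain w where w: "w \<in> V" "good (insert w F) j" by blast
      obtain c where c: "c \<in> V - F" using False less.prems(1) by blast
      \<comment> \<open>The token rule asks for an unfilled vertex; should \<open>w\<close> be
        filled already, any unfilled \<open>c\<close> does, by \<open>good_mono\<close>.\<close>
      define x where "x = (if w \<in> F then c else w)"
      have x: "x \<in> V - F" "insert w F \<subseteq> insert x F" using w(1) c by (auto simp: x_def)
      have "good (insert x F) j" by (rule good_mono[OF w(2) x(2)])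
      from IH[OF x(1) this] show ?thesis unfolding j by (rule zq_win.token[OF x(1)])
    qed
  qed
qed

text \<open>\<open>good_wins\<close> starts from a filled vertex, so the first token is placed
  separately; hence the successor in the bound.\<close>

lemma branching_wins:
  assumes "\<And>v. v \<in> V \<Longrightarrow> \<not> branching E v (nbr E v) (Suc (Suc k))" "V \<noteq> {}"
  shows "zq_win 1 V E (Suc k) {}"
proof -
  obtain r where r: "r \<in> V" using assms(2) by blast
  have "free {} v = nbr E v" for v by (simp add: free_def)
  then have g: "good {} (Suc k)" using assms(1) by (simp add: good_def)
  have "V \<subseteq> {} \<union> branches r (nbr E r) \<union> {r}"
  proof
    fix y assume y: "y \<in> V"
    show "y \<in> {} \<union> branches r (nbr E r) \<union> {r}"
    proof (cases "y = r")
      case False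
      then obtain n where "n \<in> nbr E r" "y \<in> branch r n" by (rule vertex_cases[OF r y])
      then show ?thesis by (auto simp: branches_def)
    qed simp
  qed
  then obtain w where w: "w \<in> V" "good {w} k"
    using token_exists[OF g r order_refl Int_empty_right] by blast
  then have "zq_win 1 V E k {w}" by (intro good_wins) auto
  then show ?thesis by (rule zq_win.token[rotated]) (use w(1) in simp)
qed

text \<open>Makes the optimum positive, as \<open>branching_wins\<close> requires. If all degrees
  were at most one, a vertex and its only neighbor would exhaust the tree.\<close>

lemma ex_branching_one:
  assumes "3 \<le> card V"
  obtains v where "v \<in> V" "branching E v (nbr E v) 1"
proof (cases "\<exists>v\<in>V. 2 \<le> card (nbr E v)")
  case True
  then obtain v where "v \<in> V" "2 \<le> card (nbr E v)" by blast
  then show ?thesis using that[of v] branching_one[of "nbr E v" E v] by simp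
next
  case False
  then have le: "a = b" if "a \<in> nbr E v" "b \<in> nbr E v" for a b v
    using that nbr_in[of a v] card_le_Suc0_iff_eq[of "nbr E v"] finite_nbr
    by (metis not_less_eq_eq numeral_2_eq_2)
  have "V \<noteq> {}" using assms by auto
  then obtain v where v: "v \<in> V" by blast
  have "V \<subseteq> insert v (nbr E v)"
  proof
    fix y assume y: "y \<in> V"
    show "y \<in> insert v (nbr E v)"
    proof (rule ccontr)
      assume no: "y \<notin> insert v (nbr E v)"
      then have "y \<noteq> v" by simp
      then obtain n where n: "n \<in> nbr E v" "y \<in> branch v n" by (rule vertex_cases[OF v y])
      then have "y \<noteq> n" using no by blast
      then obtain m where "m \<in> nbr E n" "m \<noteq> v" by (rule branch_cases[OF n])
      then show False using le[of m n v] nbr_sym[OF n(1)] by blast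
    qed
  qed
  then have "card V \<le> card (insert v (nbr E v))" by (intro card_mono) auto
  also have "\<dots> \<le> Suc (card (nbr E v))" by (simp add: card_insert_if)
  also have "\<dots> \<le> 2" using False v by auto
  finally show ?thesis using assms by simp
qed

subsection \<open>Optimal subtrees\<close>

lemma subgraph_acyclic:
  assumes "ES \<subseteq> E"
  shows "\<not> (\<exists>c. is_cycle ES c)"
proof
  assume "\<exists>c. is_cycle ES c"
  then obtain c where "is_cycle ES c" ..
  then have "is_cycle E c" using assms walk_edges_mono unfolding is_cycle_def by blast
  then show False using acyclic by blast
qed

text \<open>\<open>q\<close> is the part of the path already traversed from the root, and
  \<open>x\<close> comes next. The constant is 2 at the root and 1 below it, since a root with
  \<open>c\<close> children has degree \<open>c\<close> and any other vertex degree
  \<open>c + 1\<close>; so a vertex without children gets 0 in both cases.\<close>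

lemma subtree_branching:
  assumes ES: "ES \<subseteq> E" "simple_graph W ES"
    and "x \<in> V" "path_from ES v (q @ [x])"
    and "\<And>s. path_from ES v (q @ x # s) \<Longrightarrow> leaf_path ES (q @ x # s) \<Longrightarrow>
      int k \<le> (\<Sum>w\<in>set (x # s). int (deg ES w) - 2) + (if q = [] then 2 else 1)"
  shows "branching E x (nbr E x - set q) k"
  using assms(3-)
proof (induction "card (V - set q)" arbitrary: q x k rule: less_induct)
  case less
  define M where "M = nbr ES x - set q"
  have path: "distinct (q @ [x])" "walk_edges ES (q @ [x])"
    using less.prems(2) by (auto simp: path_from_def)
  have nbrE: "nbr ES x \<subseteq> nbr E x" using ES by (auto simp: nbr_def)
  have finM: "finite M" unfolding M_def using nbrE finite_nbr finite_subset by blast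
  \<comment> \<open>Only the predecessor of \<open>x\<close> can be a neighbor of \<open>x\<close>
    on \<open>q\<close>; any other would give a chord.\<close>
  have "nbr ES x \<subseteq> M \<union> (if q = [] then {} else {last q})"
  proof
    fix y assume y: "y \<in> nbr ES x"
    show "y \<in> M \<union> (if q = [] then {} else {last q})"
    proof (cases "y \<in> set q")
      case True
      then obtain i where i: "i < length q" "y = q ! i" by (auto simp: in_set_conv_nth)
      have "{(q @ [x]) ! i, (q @ [x]) ! length q} \<in> ES"
        using y i by (simp add: nbr_def nth_append insert_commute)
      then have "length q = Suc i"
        using acyclic_chord[OF subgraph_acyclic[OF ES(1)] path, of i "length q"] i(1) by simp
      moreover have "q \<noteq> []" using True by auto
      ultimately show ?thesis using i(2) by (simp add: last_conv_nth)
    qed (use y in \<open>simp add: M_def\<close>)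
  qed
  then have "card (nbr ES x) \<le> card (M \<union> (if q = [] then {} else {last q}))"
    using finM by (intro card_mono) auto
  also have "\<dots> \<le> card M + card (if q = [] then {} else {last q})" by (rule card_Un_le)
  finally have deg: "deg ES x \<le> card M + (if q = [] then 0 else 1)"
    by (simp add: deg_eq_card_nbr[OF ES(2)] split: if_splits)
  show ?case
  proof (cases "M = {}")
    case True
    then have "leaf_path ES (q @ [x])" by (auto simp: leaf_path_def M_def nbr_def)
    then have "int k \<le> int (deg ES x) - 2 + (if q = [] then 2 else 1)"
      using less.prems(3)[of "[]"] less.prems(2) by simp
    then have "k = 0" using deg True by (simp split: if_splits)
    then show ?thesis by (simp add: branching.zero)
  next
    case False
    show ?thesis
    proof (rule branching.node[OF _ False])
      show "M \<subseteq> nbr E x - set q" using nbrE by (auto simp: M_def)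
      fix n assume n: "n \<in> M"
      show "branching E n (nbr E n - {x}) (Suc k - card M)"
      proof (cases "Suc k \<le> card M")
        case True
        then show ?thesis by (simp add: branching.zero)
      next
        case k: False
        have nx: "{x, n} \<in> ES" "n \<notin> set q" "n \<noteq> x" "n \<in> V"
          using n nbrE nbr_in[of n x] by (auto simp: M_def nbr_def)
        have "branching E n (nbr E n - set (q @ [x])) (Suc k - card M)"
        proof (rule less.hyps)
          show "card (V - set (q @ [x])) < card (V - set q)"
            by (rule psubset_card_mono) (use less.prems(1) path(1) in auto)
          show "n \<in> V" by fact
          have "walk_edges ES ((q @ [x]) @ [n])"
            using path(2) nx(1) by (subst walk_edges_append) (simp add: walk_edges_Cons)
          then show "path_from ES v ((q @ [x]) @ [n])"
            using less.prems(2) nx by (auto simp: path_from_def hd_append)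
          fix s assume s: "path_from ES v ((q @ [x]) @ n # s)" "leaf_path ES ((q @ [x]) @ n # s)"
          have "x \<notin> set (n # s)" using s(1) by (auto simp: path_from_def)
          then have "(\<Sum>w\<in>set (x # n # s). int (deg ES w) - 2) =
              int (deg ES x) - 2 + (\<Sum>w\<in>set (n # s). int (deg ES w) - 2)"
            by simp
          \<comment> \<open>\<open>deg ES x - 2\<close> plus the constant at \<open>x\<close> is at
            most \<open>card M\<close>; this turns the bound \<open>k\<close> at \<open>x\<close>
            into \<open>Suc k - card M\<close> with constant 1 at \<open>n\<close>.\<close>
          then show "int (Suc k - card M) \<le> (\<Sum>w\<in>set (n # s). int (deg ES w) - 2) +
              (if q @ [x] = [] then 2 else 1)"
            using less.prems(3)[of "n # s"] s deg k by (simp split: if_splits)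
        qed
        then show ?thesis by (rule branching_mono) auto
      qed
    qed
  qed
qed

text \<open>The subtrees obtained for the children in \<open>M\<close> are joined to
  \<open>v\<close> by edges. Confining each to its branch keeps them disjoint, so a path from
  \<open>v\<close> continues inside a single one.\<close>

lemma branching_subtree:
  assumes "branching E v N k" "v \<in> V" "N \<subseteq> nbr E v"
  shows "\<exists>W ES. is_subtree V E W ES \<and> v \<in> W \<and> W \<subseteq> insert v (branches v N) \<and>
    (\<forall>p. path_from ES v p \<longrightarrow> leaf_path ES p \<longrightarrow> int k \<le> 2 + (\<Sum>w\<in>set p. int (deg ES w) - 2))"
  using assms
proof (induction rule: branching.induct)
  case (zero v N)
  have "is_subtree V E {v} {}"
    using zero
    by (auto simp: is_subtree_def is_tree_def simple_graph_def connected_graph_def is_cycle_def)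
  moreover have "int 0 \<le> 2 + (\<Sum>w\<in>set p. int (deg {} w) - 2)" if "path_from {} v p" for p
  proof -
    have "p = [v]" using that by (cases p) (auto simp: path_from_def walk_edges_Cons)
    then show ?thesis by (simp add: deg_def)
  qed
  ultimately show ?case by (intro exI[of _ "{v}"] exI[of _ "{}"]) auto
next
  case (node M N v k)
  let ?Q = "\<lambda>n X. is_subtree V E (fst X) (snd X) \<and> n \<in> fst X \<and>
      fst X \<subseteq> insert n (branches n (nbr E n - {v})) \<and>
      (\<forall>p. path_from (snd X) n p \<longrightarrow> leaf_path (snd X) p \<longrightarrow>
        int (Suc k - card M) \<le> 2 + (\<Sum>w\<in>set p. int (deg (snd X) w) - 2))"
  have Mn: "M \<subseteq> nbr E v" using node.hyps(1) node.prems(2) by blast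
  then have finM: "finite M" using finite_nbr finite_subset by blast
  have "\<exists>X. ?Q n X" if n: "n \<in> M" for n
  proof -
    have "n \<in> V" using n Mn nbr_in by blast
    then show ?thesis using node.IH[OF n] by auto
  qed
  then obtain f where f: "\<And>n. n \<in> M \<Longrightarrow> ?Q n (f n)" by metis
  define Ws where "Ws n = fst (f n)" for n
  define Es where "Es n = snd (f n)" for n
  have sub: "is_subtree V E (Ws n) (Es n)" "n \<in> Ws n"
    "Ws n \<subseteq> insert n (branches n (nbr E n - {v}))" if "n \<in> M" for n
    using f[OF that] by (auto simp: Ws_def Es_def)
  have val: "int (Suc k - card M) \<le> 2 + (\<Sum>w\<in>set p. int (deg (Es n) w) - 2)"
    if "n \<in> M" "path_from (Es n) n p" "leaf_path (Es n) p" for n p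
    using f[OF that(1)] that(2,3) by (simp add: Es_def)
  have br: "Ws n \<subseteq> branch v n" if n: "n \<in> M" for n
  proof -
    have "n \<in> nbr E v" using n Mn by blast
    then have "branches n (nbr E n - {v}) \<subseteq> branch v n"
      using branch_child[of n v] unfolding branches_def by blast
    then show ?thesis using sub(3)[OF n] by auto
  qed
  have notv: "v \<notin> Ws n" if n: "n \<in> M" for n
    using br[OF n] branch_subset[of n v] Mn n by blast
  have Ein: "e \<subseteq> Ws n" "card e = 2" "e \<in> E" if "n \<in> M" "e \<in> Es n" for n e
    using sub(1)[OF that(1)] that(2) by (auto simp: is_subtree_def is_tree_def simple_graph_def)
  have WsV: "Ws n \<subseteq> V" if "n \<in> M" for n using sub(1)[OF that] by (simp add: is_subtree_def)
  define W where "W = insert v (\<Union>n\<in>M. Ws n)"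
  define ES where "ES = (\<Union>n\<in>M. Es n) \<union> (\<lambda>n. {v, n}) ` M"
  have WV: "W \<subseteq> V" using WsV node.prems(1) by (auto simp: W_def)
  have ME: "{v, n} \<in> E" "v \<noteq> n" if "n \<in> M" for n
    using that Mn nbr_in[of n v] by (auto simp: nbr_def)
  have ESE: "ES \<subseteq> E" using Ein(3) ME by (auto simp: ES_def)
  have ESW: "e \<subseteq> W" if "e \<in> ES" for e
    using that Ein(1) sub(2) unfolding ES_def W_def by blast
  have finW: "finite W" using WV finite_V finite_subset by blast
  have simple: "simple_graph W ES"
    using tree ESE ESW finW by (auto simp: simple_graph_def is_tree_def)
  have reach: "(adj_in ES W)\<^sup>*\<^sup>* v y" if y: "y \<in> W" for y
  proof (cases "y = v")
    case False
    then obtain n where n: "n \<in> M" "y \<in> Ws n" using y by (auto simp: W_def)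
    have "adj_in ES W v n" using n(1) sub(2)[OF n(1)] by (auto simp: adj_in_def ES_def W_def)
    moreover have "(adj_in (Es n) (Ws n))\<^sup>*\<^sup>* n y"
      using sub(1,2)[OF n(1)] n(2) by (auto simp: is_subtree_def is_tree_def connected_graph_def)
    moreover have "adj_in (Es n) (Ws n) \<le> adj_in ES W"
      using n(1) by (auto simp: adj_in_def ES_def W_def)
    ultimately show ?thesis by (meson converse_rtranclp_into_rtranclp rtranclp_mono rev_predicate2D)
  qed simp
  have "connected_graph W ES"
    unfolding connected_graph_def
    using reach rtranclp_adj_in_sym rtranclp_trans by (metis W_def insert_not_empty)
  then have subtree: "is_subtree V E W ES"
    using simple subgraph_acyclic[OF ESE] WV ESE by (simp add: is_subtree_def is_tree_def)
  have WN: "W \<subseteq> insert v (branches v N)"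
    using br node.hyps(1) unfolding W_def branches_def by blast
  have finES: "finite ES" using ESW finW by (meson Pow_iff finite_Pow_iff finite_subset subsetI)
  have inside: "{y, z} \<in> Es n" if h: "n \<in> M" "y \<in> Ws n" "{y, z} \<in> ES" "z \<noteq> v" for n y z
  proof -
    have yv: "y \<noteq> v" using h notv by blast
    have "\<not> (\<exists>m\<in>M. {y, z} = {v, m})" using yv h(4) by (auto simp: doubleton_eq_iff)
    then obtain m where m: "m \<in> M" "{y, z} \<in> Es m" using h(3) by (auto simp: ES_def)
    then have "y \<in> branch v m" using Ein(1) br by blast
    moreover have "y \<in> branch v n" using h br by blast
    ultimately have "m = n" using branch_disjoint[of n v m y] h(1) m(1) Mn by blast
    then show ?thesis using m by simp
  qed
  have walk: "walk_edges (Es n) s"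
    if "n \<in> M" "s \<noteq> []" "hd s \<in> Ws n" "walk_edges ES s" "v \<notin> set s" for n s
    using that(2-)
  proof (induction s)
    case (Cons y s)
    show ?case
    proof (cases "s = []")
      case False
      then have yz: "{y, hd s} \<in> ES" "hd s \<noteq> v" "walk_edges ES s"
        using Cons.prems hd_in_set[of s] by (auto simp: walk_edges_Cons)
      then have e: "{y, hd s} \<in> Es n" using inside[OF that(1)] Cons.prems by simp
      then have "hd s \<in> Ws n" using Ein(1)[OF that(1)] by blast
      then show ?thesis using e yz Cons False by (simp add: walk_edges_Cons)
    qed (simp add: walk_edges_Cons)
  qed simp
  have "int k \<le> 2 + (\<Sum>w\<in>set p. int (deg ES w) - 2)"
    if p: "path_from ES v p" "leaf_path ES p" for p
  proof -
    obtain s where s: "p = v # s" using p(1) by (cases p) (auto simp: path_from_def)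
    obtain m where m: "m \<in> M" using node.hyps(2) by blast
    have "s \<noteq> []"
    proof
      assume "s = []"
      then have "m \<in> {v}" using p(2) m by (auto simp: leaf_path_def s ES_def)
      then show False using ME(2)[OF m] by simp
    qed
    define n where "n = hd s"
    have ps: "distinct s" "v \<notin> set s" "walk_edges ES s" "{v, n} \<in> ES"
      using p(1) \<open>s \<noteq> []\<close> by (auto simp: path_from_def s walk_edges_Cons n_def)
    have "{v, n} \<notin> Es m" if "m \<in> M" for m using Ein(1)[OF that, of "{v, n}"] notv[OF that] by blast
    then have n: "n \<in> M" using ps(4) by (auto simp: ES_def doubleton_eq_iff)
    have "path_from (Es n) n s"
      using walk[OF n \<open>s \<noteq> []\<close>] sub(2)[OF n] ps \<open>s \<noteq> []\<close> by (simp add: path_from_def n_def)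
    moreover have "leaf_path (Es n) s"
      unfolding leaf_path_def
    proof (intro allI impI)
      fix z assume z: "{last s, z} \<in> Es n"
      then have "{last p, z} \<in> ES" using n \<open>s \<noteq> []\<close> by (auto simp: s ES_def)
      then have "z \<in> set p" using p(2) by (simp add: leaf_path_def)
      moreover have "z \<noteq> v" using Ein(1)[OF n z] notv[OF n] by blast
      ultimately show "z \<in> set s" by (simp add: s)
    qed
    ultimately have v1: "int (Suc k - card M) \<le> 2 + (\<Sum>w\<in>set s. int (deg (Es n) w) - 2)"
      by (rule val[OF n])
    have subn: "Es n \<subseteq> ES" "{v, n} \<in> ES" using n by (auto simp: ES_def)
    have finw: "finite {e \<in> ES. w \<in> e}" for w using finES by simp
    \<comment> \<open>Joining raises the degree of the root \<open>n\<close> by one through the edge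
      to \<open>v\<close>; this is the 1 gained in \<open>v2\<close>.\<close>
    have deg_w: "deg (Es n) w + (if w = n then 1 else 0) \<le> deg ES w" for w
    proof (cases "w = n")
      case True
      have "{v, n} \<notin> Es n" using Ein(1)[OF n, of "{v, n}"] notv[OF n] by blast
      moreover have "finite {e \<in> Es n. n \<in> e}"
        by (rule finite_subset[OF _ finES]) (use subn in auto)
      ultimately have "card (insert {v, n} {e \<in> Es n. n \<in> e}) = Suc (deg (Es n) n)"
        by (simp add: deg_def)
      moreover have "card (insert {v, n} {e \<in> Es n. n \<in> e}) \<le> deg ES n"
        unfolding deg_def by (rule card_mono[OF finw]) (use subn in auto)
      ultimately show ?thesis using True by simp
    next
      case False
      have "deg (Es n) w \<le> deg ES w"
        unfolding deg_def by (rule card_mono[OF finw]) (use subn in auto)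
      then show ?thesis using False by simp
    qed
    have "(\<Sum>w\<in>set s. int (deg (Es n) w) - 2) + 1 =
        (\<Sum>w\<in>set s. int (deg (Es n) w) - 2) + (\<Sum>w\<in>set s. if w = n then 1 else 0)"
      using \<open>s \<noteq> []\<close> by (simp add: n_def)
    also have "\<dots> = (\<Sum>w\<in>set s. int (deg (Es n) w) - 2 + (if w = n then 1 else 0))"
      by (rule sum.distrib[symmetric])
    also have "\<dots> \<le> (\<Sum>w\<in>set s. int (deg ES w) - 2)"
    proof (rule sum_mono)
      fix w
      show "int (deg (Es n) w) - 2 + (if w = n then 1 else 0) \<le> int (deg ES w) - 2"
        using deg_w[of w] by (simp split: if_splits)
    qed
    finally have v2: "(\<Sum>w\<in>set s. int (deg (Es n) w) - 2) + 1 \<le> (\<Sum>w\<in>set s. int (deg ES w) - 2)" .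
    have "card M = card ((\<lambda>n. {v, n}) ` M)"
      by (rule card_image[symmetric]) (auto simp: inj_on_def doubleton_eq_iff)
    also have "\<dots> \<le> deg ES v"
      unfolding deg_def by (rule card_mono[OF finw]) (auto simp: ES_def)
    finally have v3: "card M \<le> deg ES v" .
    have "(\<Sum>w\<in>set p. int (deg ES w) - 2) = int (deg ES v) - 2 + (\<Sum>w\<in>set s. int (deg ES w) - 2)"
      using ps(2) by (simp add: s)
    \<comment> \<open>The summand of \<open>v\<close> is at least \<open>card M - 2\<close> and the
      new edge adds 1 at \<open>n\<close>; together they make up for the drop from \<open>k\<close>
      to \<open>Suc k - card M\<close>.\<close>
    then show ?thesis using v1 v2 v3 by linarith
  qed
  then show ?case using subtree WN by (intro exI[of _ W] exI[of _ ES]) (auto simp: W_def)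
qed

text \<open>Translates the optimum over subtrees into \<open>branching\<close>. Natural
  \<open>k\<close> suffice: the one-vertex subtree has sum -2, so the shifted optimum is never
  negative.\<close>

lemma branching_iff_subtree:
  "(\<exists>W ES. is_subtree V E W ES \<and> v \<in> W \<and> int k \<le> 2 +
      Min ((\<lambda>p. \<Sum>w\<in>set p. int (deg ES w) - 2) ` {p. maximal_path_from ES v p}))
    \<longleftrightarrow> v \<in> V \<and> branching E v (nbr E v) k"
    (is "?L \<longleftrightarrow> ?R")
proof
  assume ?L
  then obtain W ES where W: "is_subtree V E W ES" "v \<in> W" and le: "int k \<le> 2 +
      Min ((\<lambda>p. \<Sum>w\<in>set p. int (deg ES w) - 2) ` {p. maximal_path_from ES v p})" by blast
  have ES: "ES \<subseteq> E" "simple_graph W ES" "v \<in> V"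
    using W by (auto simp: is_subtree_def is_tree_def)
  have "branching E v (nbr E v - set []) k"
  proof (rule subtree_branching[OF ES, where v = v])
    show "path_from ES v ([] @ [v])" by (simp add: path_from_def walk_edges_Cons)
    fix s assume "path_from ES v ([] @ v # s)" "leaf_path ES ([] @ v # s)"
    then have "maximal_path_from ES v (v # s)"
      using maximal_path_iff[OF subgraph_acyclic[OF ES(1)]] by simp
    then have "Min ((\<lambda>p. \<Sum>w\<in>set p. int (deg ES w) - 2) ` {p. maximal_path_from ES v p})
        \<le> (\<Sum>w\<in>set (v # s). int (deg ES w) - 2)"
      using maximal_paths_finite_nonempty(1)[OF ES(2) W(2)] by (intro Min_le finite_imageI imageI) auto
    then show "int k \<le> (\<Sum>w\<in>set (v # s). int (deg ES w) - 2) + (if [] = [] then 2 else 1)"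
      using le by simp
  qed
  then show ?R using ES(3) by simp
next
  assume ?R
  then obtain W ES where W: "is_subtree V E W ES" "v \<in> W" and le:
    "\<And>p. path_from ES v p \<Longrightarrow> leaf_path ES p \<Longrightarrow> int k \<le> 2 + (\<Sum>w\<in>set p. int (deg ES w) - 2)"
    using branching_subtree[of v "nbr E v" k] by blast
  have ES: "ES \<subseteq> E" "simple_graph W ES" using W by (auto simp: is_subtree_def is_tree_def)
  have "Min ((\<lambda>p. \<Sum>w\<in>set p. int (deg ES w) - 2) ` {p. maximal_path_from ES v p})
      \<in> (\<lambda>p. \<Sum>w\<in>set p. int (deg ES w) - 2) ` {p. maximal_path_from ES v p}"
    using maximal_paths_finite_nonempty[OF ES(2) W(2)] by (intro Min_in) auto
  then obtain p where p: "maximal_path_from ES v p"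
    "Min ((\<lambda>p. \<Sum>w\<in>set p. int (deg ES w) - 2) ` {p. maximal_path_from ES v p}) =
      (\<Sum>w\<in>set p. int (deg ES w) - 2)" by auto
  have "int k \<le> 2 + (\<Sum>w\<in>set p. int (deg ES w) - 2)"
    using le p(1) maximal_path_iff[OF subgraph_acyclic[OF ES(1)]] by blast
  then show ?L using W p(2) by (intro exI[of _ W] exI[of _ ES]) simp
qed

section \<open>The range of subtrees is finite and nonempty, so the maxima are attained\<close>

lemma finite_subtrees: "finite {(W, ES). is_subtree V E W ES \<and> v \<in> W}"
proof (rule finite_subset)
  show "{(W, ES). is_subtree V E W ES \<and> v \<in> W} \<subseteq> Pow V \<times> Pow E" by (auto simp: is_subtree_def)
  have "E \<subseteq> Pow V" using tree by (auto simp: is_tree_def simple_graph_def)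
  then have "finite E" by (rule finite_subset) simp
  then show "finite (Pow V \<times> Pow E)" by simp
qed

lemma trivial_subtree: "v \<in> V \<Longrightarrow> is_subtree V E {v} {}"
  by (auto simp: is_subtree_def is_tree_def simple_graph_def connected_graph_def is_cycle_def)

end

theorem theorem4p1:
  fixes V :: "'a set" and E :: "'a set set"
  assumes "is_tree V E" and "card V \<ge> 3"
  shows "int (Zq 1 V E) = 2 + Max ((\<lambda>v. Max ((\<lambda>(W, ES).
            Min ((\<lambda>p. \<Sum>w\<in>set p. int (deg ES w) - 2) ` {p. maximal_path_from ES v p}))
          ` {(W, ES). is_subtree V E W ES \<and> v \<in> W})) ` V)"
proof -
  interpret tree V E by standard (rule assms(1))
  define val where "val v X = (case X of (W :: 'a set, ES) \<Rightarrow>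
    Min ((\<lambda>p. \<Sum>w\<in>set p. int (deg ES w) - 2) ` {p. maximal_path_from ES v p}))" for v :: 'a and X
  define A where "A v = {(W, ES). is_subtree V E W ES \<and> v \<in> W}" for v :: 'a
  define m where "m = Max ((\<lambda>v. Max (val v ` A v)) ` V)"
  have V: "V \<noteq> {}" using assms(2) by auto
  have A: "finite (A v)" "A v \<noteq> {}" if "v \<in> V" for v
    using finite_subtrees trivial_subtree[OF that] by (auto simp: A_def)
  have iff: "(\<exists>X\<in>A v. int k \<le> 2 + val v X) \<longleftrightarrow> v \<in> V \<and> branching E v (nbr E v) k" for v k
    unfolding branching_iff_subtree[symmetric] A_def val_def by auto
  have le: "val v X \<le> m" if "v \<in> V" "X \<in> A v" for v X
  proof -
    have "val v X \<le> Max (val v ` A v)" using A[OF that(1)] that(2) by (intro Max_ge) auto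
    also have "\<dots> \<le> m" unfolding m_def using that(1) by (intro Max_ge) auto
    finally show ?thesis .
  qed
  have "m \<in> (\<lambda>v. Max (val v ` A v)) ` V" unfolding m_def using V by (intro Max_in) auto
  then obtain v where v: "v \<in> V" "m = Max (val v ` A v)" by blast
  have "Max (val v ` A v) \<in> val v ` A v" using A[OF v(1)] by (intro Max_in) auto
  then obtain X where X: "X \<in> A v" "m = val v X" using v(2) by auto
  obtain u where "u \<in> V" "branching E u (nbr E u) 1" by (rule ex_branching_one[OF assms(2)])
  then obtain Y where Y: "Y \<in> A u" "int 1 \<le> 2 + val u Y" using iff[of u 1] by blast
  \<comment> \<open>The optimum is therefore of the form \<open>Suc k\<close>, as needed for
    \<open>branching_wins\<close>.\<close>
  then have "1 \<le> 2 + m" using le[OF \<open>u \<in> V\<close> Y(1)] by simp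
  define k where "k = nat (1 + m)"
  have k: "int (Suc k) = 2 + m" using \<open>1 \<le> 2 + m\<close> by (simp add: k_def)
  have "branching E v (nbr E v) (Suc k)" using iff[of v "Suc k"] X k by auto
  have none: "\<not> branching E w (nbr E w) (Suc (Suc k))" if w: "w \<in> V" for w
  proof
    assume "branching E w (nbr E w) (Suc (Suc k))"
    then obtain Z where Z: "Z \<in> A w" "int (Suc (Suc k)) \<le> 2 + val w Z"
      using iff[of w "Suc (Suc k)"] w by blast
    then show False using le[OF w Z(1)] k by simp
  qed
  have "Zq 1 V E = Suc k"
    unfolding Zq_def
  proof (rule Least_equality)
    show "zq_win 1 V E (Suc k) {}" using branching_wins[OF none V] .
    fix j assume "zq_win 1 V E j {}"
    then have "\<not> branching E v (nbr E v) (Suc j)" by (rule zq_win_not_branching[OF _ v(1)])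
    then show "Suc k \<le> j"
      using branching_antimono[OF \<open>branching E v (nbr E v) (Suc k)\<close>, of "Suc j"] by linarith
  qed
  then show ?thesis using k unfolding m_def val_def A_def by simp
qed

end
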